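(* Let $\mu$ be a regular cardinal and let $\mathbf{K}$ be a pseudo-universal $\mu$-AEC that does not contain the empty structure. Then there is a functorial expansion $\widehat{\mathbf{K}}$ of $\mathbf{K}$ which is a universal $\mu$-AEC. Moreover, $|\tau(\widehat{\mathbf{K}})| \le 2^{\operatorname{LS}(\mathbf{K})}$.
   Context: Throughout, $\mu$ is a regular cardinal. A vocabulary is $\mu$-ary if all its symbols have arity $<\mu$. For a structure $M$, $UM$ is its universe. An abstract class is a pair $\mathbf{K}=(K,\le_{\mathbf{K}})$ where $K$ is a class of structures in a fixed $\mu$-ary vocabulary $\tau(\mathbf{K})$, closed under isomorphism, and $\le_{\mathbf{K}}$ is a partial order on $K$ respecting isomorphisms and extending the substructure relation. A $\mathbf{K}$-embedding $f:M\to N$ is an isomorphism from $M$ onto $f[M]$ with $f[M]\le_{\mathbf{K}} N$; with these morphisms $\mathbf{K}$ is a category. A $\mu$-AEC is an abstract class satisfying: (Coherence) if $M_0\subseteq M_1\le_{\mathbf{K}} M_2$ and $M_0\le_{\mathbf{K}}M_2$ then $M_0\le_{\mathbf{K}} M_1$; (Chain axioms) for any $\mu$-directed system $\langle M_i:i\in I\rangle$ in $\mathbf{K}$ (with respect to $\le_{\mathbf{K}}$), $M:=\bigcup_i M_i\in K$, $M_i\le_{\mathbf{K}}M$ for all $i$, and if $M_i\le_{\mathbf{K}}N$ for all $i$ then $M\le_{\mathbf{K}}N$; (LST axiom) there is a cardinal $\lambda=\lambda^{<\mu}\ge|\tau(\mathbf{K})|+\mu$ such that for any $M\in K$ and $A\subseteq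 UM$ there is $M_0\le_{\mathbf{K}}M$ with $A\subseteq UM_0$ and $|UM_0|\le|A|^{<\mu}+\lambda$; $\operatorname{LS}(\mathbf{K})$ is the least such $\lambda$. A $\mu$-universal class is a class of structures in a $\mu$-ary vocabulary closed under isomorphism, substructures, and unions of $\mu$-directed systems of substructure inclusions. A universal $\mu$-AEC is a $\mu$-universal class $K$ equipped with $\le_{\mathbf{K}}=\subseteq$ (substructure). A $\mu$-AEC admits intersections if for every $N\in K$ and $A\subseteq UN$, the set $\mathbf{cl}^N(A):=\bigcap\{UM: M\le_{\mathbf{K}}N, A\subseteq UM\}$ is the universe of some $M\le_{\mathbf{K}}N$ (also denoted $\mathbf{cl}^N(A)$). It is pseudo-universal if it admits intersections and whenever $f,g:M\to N$ are $\mathbf{K}$-embeddings and $A\subseteq UM$ with $f\restriction A=g\restriction A$, then $f\restriction\mathbf{cl}^M(A)=g\restriction\mathbf{cl}^M(A)$. A functorial expansion of an abstract class $\mathbf{K}$ is an abstract class $\widehat{\mathbf{K}}$ in a vocabulary $\widehat\tau\supseteq\tau(\mathbf{K})$ such that the reduct map $M\mapsto M\restriction\tau(\mathbf{K})$ is an isomorphism of concrete categories from $\widehat{\mathbf{K}}$ onto $\mathbf{K}$ (a bijection on objects, and a map is a $\widehat{\mathbf{K}}$-embedding iff it is a $\mathbf{K}$-embedding between the reducts). *)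

theory Defs
  imports Main "HOL-Library.FuncSet"
begin

unbundle cardinal_syntax

text \<open>
  The type \<open>'a\<close> plays the role of the set-theoretic universe. Its subsets are the classes, and the
  subsets of cardinality strictly below that of \<open>'a\<close> are the sets. For \<open>'a\<close> of inaccessible
  cardinality this is the usual distinction between sets and proper classes; nothing about the
  cardinality of \<open>'a\<close> is assumed.
\<close>

definition set_sized :: "'a set \<Rightarrow> bool" where
  "set_sized X \<longleftrightarrow> |X| <o |UNIV :: 'a set|"

text \<open>
  The arity of a symbol is given by the set of its argument positions, so that an argument tuple of
  \<open>s\<close> over \<open>U\<close> is an element of \<open>arity \<tau> s \<rightarrow>\<^sub>E U\<close>. Constants are function symbols without argument
  positions.
\<close>

record ('s, 'i) vocabulary =
  Funs :: "'s set"
  Rels :: "'s set"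
  arity :: "'s \<Rightarrow> 'i set"

definition symbols :: "('s, 'i) vocabulary \<Rightarrow> 's set" where
  "symbols \<tau> = Funs \<tau> \<union> Rels \<tau>"

definition ary_vocabulary :: "'i rel \<Rightarrow> ('s, 'i) vocabulary \<Rightarrow> bool" where
  "ary_vocabulary \<mu> \<tau> \<longleftrightarrow> Funs \<tau> \<inter> Rels \<tau> = {} \<and> (\<forall>s \<in> symbols \<tau>. |arity \<tau> s| <o \<mu>)"

record ('s, 'i, 'a) struct =
  univ :: "'a set"
  fint :: "'s \<Rightarrow> ('i \<Rightarrow> 'a) \<Rightarrow> 'a"
  rint :: "'s \<Rightarrow> ('i \<Rightarrow> 'a) set"

text \<open>
  Interpretations are fixed to default values on symbols outside the vocabulary and on tuples
  outside the universe, so that equality of structures is equality in HOL. Empty universes are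
  allowed.
\<close>

definition is_structure :: "('s, 'i) vocabulary \<Rightarrow> ('s, 'i, 'a) struct \<Rightarrow> bool" where
  "is_structure \<tau> M \<longleftrightarrow>
     set_sized (univ M) \<and>
     (\<forall>s \<in> Funs \<tau>. fint M s \<in> (arity \<tau> s \<rightarrow>\<^sub>E univ M) \<rightarrow>\<^sub>E univ M) \<and>
     (\<forall>s. s \<notin> Funs \<tau> \<longrightarrow> fint M s = (\<lambda>_. undefined)) \<and>
     (\<forall>s \<in> Rels \<tau>. rint M s \<subseteq> (arity \<tau> s \<rightarrow>\<^sub>E univ M)) \<and>
     (\<forall>s. s \<notin> Rels \<tau> \<longrightarrow> rint M s = {})"

definition substructure ::
    "('s, 'i) vocabulary \<Rightarrow> ('s, 'i, 'a) struct \<Rightarrow> ('s, 'i, 'a) struct \<Rightarrow> bool" where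
  "substructure \<tau> M N \<longleftrightarrow>
     is_structure \<tau> M \<and> is_structure \<tau> N \<and> univ M \<subseteq> univ N \<and>
     (\<forall>s \<in> Funs \<tau>. \<forall>x \<in> arity \<tau> s \<rightarrow>\<^sub>E univ M. fint M s x = fint N s x) \<and>
     (\<forall>s \<in> Rels \<tau>. rint M s = rint N s \<inter> (arity \<tau> s \<rightarrow>\<^sub>E univ M))"

definition struct_iso ::
    "('s, 'i) vocabulary \<Rightarrow> ('a \<Rightarrow> 'a) \<Rightarrow> ('s, 'i, 'a) struct \<Rightarrow> ('s, 'i, 'a) struct \<Rightarrow> bool" where
  "struct_iso \<tau> f M N \<longleftrightarrow>
     is_structure \<tau> M \<and> is_structure \<tau> N \<and> bij_betw f (univ M) (univ N) \<and>
     (\<forall>s \<in> Funs \<tau>. \<forall>x \<in> arity \<tau> s \<rightarrow>\<^sub>E univ M.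
        f (fint M s x) = fint N s (compose (arity \<tau> s) f x)) \<and>
     (\<forall>s \<in> Rels \<tau>. \<forall>x \<in> arity \<tau> s \<rightarrow>\<^sub>E univ M.
        x \<in> rint M s \<longleftrightarrow> compose (arity \<tau> s) f x \<in> rint N s)"

text \<open>
  The union of a directed family. The description operator is meaningful there: each argument tuple
  lies in some member of the family, and the members agree on the value.
\<close>

definition union_struct ::
    "('s, 'i) vocabulary \<Rightarrow> ('s, 'i, 'a) struct set \<Rightarrow> ('s, 'i, 'a) struct" where
  "union_struct \<tau> D =
     \<lparr>univ = (\<Union>M \<in> D. univ M),
      fint = (\<lambda>s. if s \<in> Funs \<tau>
                 then (\<lambda>x \<in> arity \<tau> s \<rightarrow>\<^sub>E (\<Union>M \<in> D. univ M).
                         THE y. \<exists>M \<in> D. x \<in> (arity \<tau> s \<rightarrow>\<^sub>E univ M) \<and> y = fint M s x)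
                 else (\<lambda>_. undefined)),
      rint = (\<lambda>s. \<Union>M \<in> D. rint M s)\<rparr>"

text \<open>
  A directed system \<open>\<langle>M\<^sub>i : i \<in> I\<rangle>\<close> is represented by the set \<open>{M\<^sub>i : i \<in> I}\<close>, which is directed by the
  order itself. Its union is required to be a set; for inaccessible \<open>'a\<close> and a vocabulary that is
  a set this is the same as the system being a set.
\<close>

definition directed_system ::
    "'i rel \<Rightarrow> ('s, 'i, 'a) struct rel \<Rightarrow> ('s, 'i, 'a) struct set \<Rightarrow> bool" where
  "directed_system \<mu> le D \<longleftrightarrow>
     (\<forall>S \<subseteq> D. |S| <o \<mu> \<longrightarrow> (\<exists>N \<in> D. \<forall>M \<in> S. (M, N) \<in> le)) \<and>
     set_sized (\<Union>M \<in> D. univ M)"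

record ('s, 'i, 'a) aclass =
  voc :: "('s, 'i) vocabulary"
  Mod :: "('s, 'i, 'a) struct set"
  le :: "('s, 'i, 'a) struct rel"

definition closed_under_iso ::
    "('s, 'i) vocabulary \<Rightarrow> ('s, 'i, 'a) struct set \<Rightarrow> bool" where
  "closed_under_iso \<tau> K \<longleftrightarrow> (\<forall>M N f. M \<in> K \<and> struct_iso \<tau> f M N \<longrightarrow> N \<in> K)"

definition abstract_class :: "'i rel \<Rightarrow> ('s, 'i, 'a) aclass \<Rightarrow> bool" where
  "abstract_class \<mu> K \<longleftrightarrow>
     ary_vocabulary \<mu> (voc K) \<and>
     (\<forall>M \<in> Mod K. is_structure (voc K) M) \<and>
     closed_under_iso (voc K) (Mod K) \<and>
     partial_order_on (Mod K) (le K) \<and>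
     (\<forall>M N M' N' f. (M, N) \<in> le K \<and> struct_iso (voc K) f N N' \<and> struct_iso (voc K) f M M'
        \<longrightarrow> (M', N') \<in> le K) \<and>
     (\<forall>M N. (M, N) \<in> le K \<longrightarrow> substructure (voc K) M N)"

definition K_embedding ::
    "('s, 'i, 'a) aclass \<Rightarrow> ('a \<Rightarrow> 'a) \<Rightarrow> ('s, 'i, 'a) struct \<Rightarrow> ('s, 'i, 'a) struct \<Rightarrow> bool" where
  "K_embedding K f M N \<longleftrightarrow>
     M \<in> Mod K \<and> N \<in> Mod K \<and> (\<exists>M'. struct_iso (voc K) f M M' \<and> (M', N) \<in> le K)"

definition coherence :: "('s, 'i, 'a) aclass \<Rightarrow> bool" where
  "coherence K \<longleftrightarrow>
     (\<forall>M0 M1 M2. substructure (voc K) M0 M1 \<and> (M1, M2) \<in> le K \<and> (M0, M2) \<in> le K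
        \<longrightarrow> (M0, M1) \<in> le K)"

definition chain_axioms :: "'i rel \<Rightarrow> ('s, 'i, 'a) aclass \<Rightarrow> bool" where
  "chain_axioms \<mu> K \<longleftrightarrow>
     (\<forall>D \<subseteq> Mod K. directed_system \<mu> (le K) D \<longrightarrow>
        union_struct (voc K) D \<in> Mod K \<and>
        (\<forall>M \<in> D. (M, union_struct (voc K) D) \<in> le K) \<and>
        (\<forall>N \<in> Mod K. (\<forall>M \<in> D. (M, N) \<in> le K) \<longrightarrow> (union_struct (voc K) D, N) \<in> le K))"

text \<open>
  The sequences of length \<open>< \<mu>\<close> in \<open>A\<close>, lengths being the elements of the well-order \<open>\<mu>\<close>; their
  number is \<open>|A|\<^bsup><\<mu>\<^esup>\<close>.
\<close>

definition seqs_below :: "'i rel \<Rightarrow> 'b set \<Rightarrow> ('i \<times> ('i \<Rightarrow> 'b)) set" where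
  "seqs_below \<mu> A = (SIGMA a : Field \<mu>. underS \<mu> a \<rightarrow>\<^sub>E A)"

definition LST_cardinal :: "'i rel \<Rightarrow> ('s, 'i, 'a) aclass \<Rightarrow> 'a rel \<Rightarrow> bool" where
  "LST_cardinal \<mu> K \<kappa> \<longleftrightarrow>
     Card_order \<kappa> \<and> set_sized (Field \<kappa>) \<and>
     \<kappa> =o |seqs_below \<mu> (Field \<kappa>)| \<and> |symbols (voc K)| +c \<mu> \<le>o \<kappa> \<and>
     (\<forall>M \<in> Mod K. \<forall>A \<subseteq> univ M. \<exists>M0. (M0, M) \<in> le K \<and> A \<subseteq> univ M0 \<and>
        |univ M0| \<le>o |seqs_below \<mu> A| +c \<kappa>)"

definition LS :: "'i rel \<Rightarrow> ('s, 'i, 'a) aclass \<Rightarrow> 'a rel" where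
  "LS \<mu> K = (SOME \<kappa>. LST_cardinal \<mu> K \<kappa> \<and> (\<forall>\<kappa>'. LST_cardinal \<mu> K \<kappa>' \<longrightarrow> \<kappa> \<le>o \<kappa>'))"

definition mu_AEC :: "'i rel \<Rightarrow> ('s, 'i, 'a) aclass \<Rightarrow> bool" where
  "mu_AEC \<mu> K \<longleftrightarrow>
     abstract_class \<mu> K \<and> coherence K \<and> chain_axioms \<mu> K \<and> (\<exists>\<kappa>. LST_cardinal \<mu> K \<kappa>)"

definition cl :: "('s, 'i, 'a) aclass \<Rightarrow> ('s, 'i, 'a) struct \<Rightarrow> 'a set \<Rightarrow> 'a set" where
  "cl K N A = \<Inter> {univ M | M. (M, N) \<in> le K \<and> A \<subseteq> univ M}"

definition admits_intersections :: "('s, 'i, 'a) aclass \<Rightarrow> bool" where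
  "admits_intersections K \<longleftrightarrow>
     (\<forall>N \<in> Mod K. \<forall>A \<subseteq> univ N. \<exists>M. (M, N) \<in> le K \<and> univ M = cl K N A)"

definition pseudo_universal :: "'i rel \<Rightarrow> ('s, 'i, 'a) aclass \<Rightarrow> bool" where
  "pseudo_universal \<mu> K \<longleftrightarrow>
     mu_AEC \<mu> K \<and> admits_intersections K \<and>
     (\<forall>M N f g A. K_embedding K f M N \<and> K_embedding K g M N \<and> A \<subseteq> univ M \<and>
        (\<forall>x \<in> A. f x = g x) \<longrightarrow> (\<forall>x \<in> cl K M A. f x = g x))"

definition mu_universal_class ::
    "'i rel \<Rightarrow> ('s, 'i) vocabulary \<Rightarrow> ('s, 'i, 'a) struct set \<Rightarrow> bool" where
  "mu_universal_class \<mu> \<tau> K \<longleftrightarrow>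
     ary_vocabulary \<mu> \<tau> \<and>
     (\<forall>M \<in> K. is_structure \<tau> M) \<and>
     closed_under_iso \<tau> K \<and>
     (\<forall>M N. N \<in> K \<and> substructure \<tau> M N \<longrightarrow> M \<in> K) \<and>
     (\<forall>D \<subseteq> K. directed_system \<mu> {(M, N). substructure \<tau> M N} D \<longrightarrow> union_struct \<tau> D \<in> K)"

definition universal_mu_AEC :: "'i rel \<Rightarrow> ('s, 'i, 'a) aclass \<Rightarrow> bool" where
  "universal_mu_AEC \<mu> K \<longleftrightarrow>
     mu_universal_class \<mu> (voc K) (Mod K) \<and>
     le K = {(M, N). M \<in> Mod K \<and> N \<in> Mod K \<and> substructure (voc K) M N}"

text \<open>
  The symbols of an expansion of a vocabulary over \<open>'s\<close> are taken from a sum type \<open>'s + 't\<close>, the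
  old symbols being embedded by \<^const>\<open>Inl\<close>.
\<close>

definition vocabulary_extends ::
    "('s + 't, 'i) vocabulary \<Rightarrow> ('s, 'i) vocabulary \<Rightarrow> bool" where
  "vocabulary_extends \<tau>' \<tau> \<longleftrightarrow>
     Inl ` Funs \<tau> \<subseteq> Funs \<tau>' \<and> Inl ` Rels \<tau> \<subseteq> Rels \<tau>' \<and>
     (\<forall>s \<in> symbols \<tau>. arity \<tau>' (Inl s) = arity \<tau> s)"

definition reduct ::
    "('s, 'i) vocabulary \<Rightarrow> ('s + 't, 'i, 'a) struct \<Rightarrow> ('s, 'i, 'a) struct" where
  "reduct \<tau> M =
     \<lparr>univ = univ M,
      fint = (\<lambda>s. if s \<in> Funs \<tau> then fint M (Inl s) else (\<lambda>_. undefined)),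
      rint = (\<lambda>s. if s \<in> Rels \<tau> then rint M (Inl s) else {})\<rparr>"

definition functorial_expansion ::
    "'i rel \<Rightarrow> ('s + 't, 'i, 'a) aclass \<Rightarrow> ('s, 'i, 'a) aclass \<Rightarrow> bool" where
  "functorial_expansion \<mu> K' K \<longleftrightarrow>
     abstract_class \<mu> K' \<and>
     vocabulary_extends (voc K') (voc K) \<and>
     bij_betw (reduct (voc K)) (Mod K') (Mod K) \<and>
     (\<forall>M \<in> Mod K'. \<forall>N \<in> Mod K'. \<forall>f.
        K_embedding K' f M N \<longleftrightarrow> K_embedding K f (reduct (voc K) M) (reduct (voc K) N))"

end

theory Submission
  imports Defs
begin

text \<open>
  Let \<open>\<kappa> = LS(K)\<close>. Every closure \<open>cl\<^sup>N(x)\<close> of a tuple \<open>x\<close> of length \<open>< \<mu>\<close> is nonempty and has at most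
  \<open>\<kappa>\<close> elements, and by pseudo-universality it has no nontrivial automorphism fixing \<open>x\<close>. Hence an
  enumeration in type \<open>\<kappa>\<close>, chosen for one representative of each isomorphism type of pairs
  \<open>(cl\<^sup>N(x), x)\<close>, transfers unambiguously to all pairs of that type. The expansion adds, for each
  length \<open>a < \<mu>\<close> and each \<open>\<xi> < \<kappa>\<close>, the operation sending a tuple \<open>x\<close> of length \<open>a\<close> to the \<open>\<xi>\<close>-th
  element of \<open>cl\<^sup>N(x)\<close>. These operations are preserved by isomorphisms and by \<open>\<le>\<^sub>K\<close>, and since \<open>cl\<^sup>N\<close>
  is determined by its values on sets of size \<open>< \<mu>\<close>, the subsets closed under them are exactly the
  universes of the \<open>\<le>\<^sub>K\<close>-substructures. Only \<open>\<kappa>\<close> new symbols are needed.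
\<close>

section \<open>Structures and isomorphisms\<close>

lemma compose_compose: "compose I g (compose I f x) = compose I (g \<circ> f) x"
  by (auto simp: compose_def)

lemma compose_in_PiE: "x \<in> I \<rightarrow>\<^sub>E U \<Longrightarrow> f ` U \<subseteq> V \<Longrightarrow> compose I f x \<in> I \<rightarrow>\<^sub>E V"
  by (auto simp: compose_def PiE_def Pi_def)

lemma compose_ident_on: "x \<in> I \<rightarrow>\<^sub>E U \<Longrightarrow> (\<And>u. u \<in> U \<Longrightarrow> f u = u) \<Longrightarrow> compose I f x = x"
  by (rule ext) (auto simp: compose_def PiE_def Pi_def extensional_def)

lemma compose_inv_into_left:
  assumes "inj_on f U" "x \<in> I \<rightarrow>\<^sub>E U"
  shows "compose I (inv_into U f) (compose I f x) = x"
  unfolding compose_compose using assms by (intro compose_ident_on) auto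

lemma compose_inv_into_right:
  assumes "y \<in> I \<rightarrow>\<^sub>E f ` U"
  shows "compose I f (compose I (inv_into U f) y) = y"
  unfolding compose_compose using assms by (intro compose_ident_on) (auto simp: f_inv_into_f)

lemma compose_inv_into_in:
  assumes "y \<in> I \<rightarrow>\<^sub>E f ` U"
  shows "compose I (inv_into U f) y \<in> I \<rightarrow>\<^sub>E U"
  using assms by (rule compose_in_PiE) (auto simp: inv_into_into)

lemma compose_inj:
  assumes "inj_on f U" "x \<in> I \<rightarrow>\<^sub>E U" "y \<in> I \<rightarrow>\<^sub>E U" "compose I f x = compose I f y"
  shows "x = y"
  using assms compose_inv_into_left by metis

lemma set_sized_subset: "set_sized B \<Longrightarrow> A \<subseteq> B \<Longrightarrow> set_sized A"
  unfolding set_sized_def using card_of_mono1 ordLeq_ordLess_trans by blast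

lemma set_sized_image: "set_sized B \<Longrightarrow> set_sized (f ` B)"
  for B :: "'a set" and f :: "'a \<Rightarrow> 'a"
  unfolding set_sized_def by (rule ordLeq_ordLess_trans[OF card_of_image])

lemma fint_in_univ:
  assumes "is_structure \<tau> M" "s \<in> Funs \<tau>" "x \<in> arity \<tau> s \<rightarrow>\<^sub>E univ M"
  shows "fint M s x \<in> univ M"
proof -
  have "fint M s \<in> (arity \<tau> s \<rightarrow>\<^sub>E univ M) \<rightarrow>\<^sub>E univ M"
    using assms(1,2) by (simp add: is_structure_def)
  then show ?thesis using assms(3) by (rule PiE_mem)
qed

lemma rint_subset: "is_structure \<tau> M \<Longrightarrow> s \<in> Rels \<tau> \<Longrightarrow> rint M s \<subseteq> arity \<tau> s \<rightarrow>\<^sub>E univ M"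
  unfolding is_structure_def by blast

text \<open>The default values in \<open>is_structure\<close> leave no freedom outside the
  vocabulary or on tuples outside the universe, so only symbols of \<tau> and, for functions, tuples
  over the universe have to be compared.\<close>

lemma structure_eqI:
  fixes M N :: "('s, 'i, 'a) struct"
  assumes "is_structure \<tau> M" "is_structure \<tau> N" "univ M = univ N"
    and f: "\<And>s x. s \<in> Funs \<tau> \<Longrightarrow> x \<in> arity \<tau> s \<rightarrow>\<^sub>E univ M \<Longrightarrow> fint M s x = fint N s x"
    and r: "\<And>s. s \<in> Rels \<tau> \<Longrightarrow> rint M s = rint N s"
  shows "M = N"
proof -
  have "fint M s = fint N s" for s
  proof (cases "s \<in> Funs \<tau>")
    case True
    then have "fint M s \<in> (arity \<tau> s \<rightarrow>\<^sub>E univ M) \<rightarrow>\<^sub>E univ M"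
      "fint N s \<in> (arity \<tau> s \<rightarrow>\<^sub>E univ M) \<rightarrow>\<^sub>E univ M"
      using assms(1-3) by (auto simp: is_structure_def)
    then show ?thesis using f[OF True] by (rule PiE_ext)
  next
    case False
    then show ?thesis using assms(1,2) by (simp add: is_structure_def)
  qed
  moreover have "rint M s = rint N s" for s
    using assms(1,2) r by (cases "s \<in> Rels \<tau>") (auto simp: is_structure_def)
  ultimately show ?thesis
    using assms(3) by (intro struct.equality) auto
qed

section \<open>Substructures\<close>

lemma substructure_subset: "substructure \<tau> M N \<Longrightarrow> univ M \<subseteq> univ N"
  by (simp add: substructure_def)

lemma substructure_refl: "is_structure \<tau> M \<Longrightarrow> substructure \<tau> M M"
  by (simp add: substructure_def Int_absorb2 rint_subset)

lemma PiE_mono_set: "U \<subseteq> V \<Longrightarrow> x \<in> I \<rightarrow>\<^sub>E U \<Longrightarrow> x \<in> I \<rightarrow>\<^sub>E V"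
  by (auto simp: PiE_def Pi_def)

lemma substructure_trans:
  assumes "substructure \<tau> M N" "substructure \<tau> N P"
  shows "substructure \<tau> M P"
proof -
  have "univ M \<subseteq> univ N" using assms substructure_subset by blast
  then have *: "x \<in> I \<rightarrow>\<^sub>E univ M \<Longrightarrow> x \<in> I \<rightarrow>\<^sub>E univ N" for x and I :: "'b set"
    by (rule PiE_mono_set)
  show ?thesis
    using assms * unfolding substructure_def by auto
qed

text \<open>Both \<open>M\<close> and \<open>M'\<close> inherit their interpretation from the common
  \<open>N\<close>. This supplies the substructure premise of the coherence axiom.\<close>

lemma substructure_within:
  assumes "substructure \<tau> M N" "substructure \<tau> M' N" "univ M \<subseteq> univ M'"
  shows "substructure \<tau> M M'"
proof -
  have *: "x \<in> I \<rightarrow>\<^sub>E univ M \<Longrightarrow> x \<in> I \<rightarrow>\<^sub>E univ M'" for x and I :: "'b set"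
    using assms(3) by (rule PiE_mono_set)
  show ?thesis
    using assms * unfolding substructure_def by auto
qed

lemma substructure_antisym:
  assumes "substructure \<tau> M N" "univ N \<subseteq> univ M"
  shows "M = N"
proof (rule structure_eqI)
  show "univ M = univ N" using assms substructure_subset by blast
  show "rint M s = rint N s" if "s \<in> Rels \<tau>" for s
    using that assms \<open>univ M = univ N\<close> rint_subset[of \<tau> N s] unfolding substructure_def by auto
qed (use assms in \<open>auto simp: substructure_def\<close>)

text \<open>The interpretation is read off from \<open>N\<close>, which leaves only the universe to
  choose. Uniqueness of this kind justifies the definite description in
  \<open>cl_struct\<close>.\<close>

lemma substructure_univ_inj:
  "substructure \<tau> M N \<Longrightarrow> substructure \<tau> M' N \<Longrightarrow> univ M = univ M' \<Longrightarrow> M = M'"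
  by (metis substructure_within substructure_antisym order_refl)

section \<open>Isomorphisms and transport of structure\<close>

lemma struct_iso_compose:
  assumes f: "struct_iso \<tau> f M N" and g: "struct_iso \<tau> g N P"
  shows "struct_iso \<tau> (g \<circ> f) M P"
proof -
  have *: "compose I f x \<in> I \<rightarrow>\<^sub>E univ N" if "x \<in> I \<rightarrow>\<^sub>E univ M" for x and I :: "'b set"
    using that f by (intro compose_in_PiE) (auto simp: struct_iso_def bij_betw_def)
  show ?thesis
    using f g * unfolding struct_iso_def
    by (auto simp: compose_compose[symmetric] intro: bij_betw_trans)
qed

lemma struct_iso_inverse:
  assumes f: "struct_iso \<tau> f M N"
  shows "struct_iso \<tau> (inv_into (univ M) f) N M"
proof -
  let ?g = "inv_into (univ M) f"
  have bij: "bij_betw f (univ M) (univ N)" and inj: "inj_on f (univ M)" and im: "f ` univ M = univ N"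
    using f by (auto simp: struct_iso_def bij_betw_def)
  have M: "is_structure \<tau> M" and N: "is_structure \<tau> N"
    using f by (auto simp: struct_iso_def)
  have *: "compose I ?g y \<in> I \<rightarrow>\<^sub>E univ M" "compose I f (compose I ?g y) = y"
    if "y \<in> I \<rightarrow>\<^sub>E univ N" for y and I :: "'b set"
    using that compose_inv_into_in[of y I f "univ M"] compose_inv_into_right[of y I f "univ M"] im
    by auto
  have "?g (fint N s y) = fint M s (compose (arity \<tau> s) ?g y)"
    if "s \<in> Funs \<tau>" "y \<in> arity \<tau> s \<rightarrow>\<^sub>E univ N" for s y
  proof -
    have "f (fint M s (compose (arity \<tau> s) ?g y)) = fint N s y"
      using f that *[OF that(2)] unfolding struct_iso_def by auto
    then show ?thesis
      using inv_into_f_f[OF inj fint_in_univ[OF M that(1) *(1)[OF that(2)]]] by simp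
  qed
  moreover have "y \<in> rint N s \<longleftrightarrow> compose (arity \<tau> s) ?g y \<in> rint M s"
    if "s \<in> Rels \<tau>" "y \<in> arity \<tau> s \<rightarrow>\<^sub>E univ N" for s y
    using f that *[OF that(2)] unfolding struct_iso_def by metis
  ultimately show ?thesis
    using bij M N unfolding struct_iso_def by (auto simp: bij_betw_inv_into)
qed

text \<open>Bijectivity writes every tuple over the target as the image of a tuple over
  \<open>M\<close>, so \<open>f\<close> and \<open>M\<close> dictate all interpretations there. This
  later serves to recognise an isomorphic copy of an expansion as an expansion.\<close>

lemma struct_iso_unique:
  assumes f: "struct_iso \<tau> f M N" and g: "struct_iso \<tau> f M N'"
  shows "N = N'"
proof (rule structure_eqI)
  show N: "is_structure \<tau> N" and N': "is_structure \<tau> N'"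
    using f g by (auto simp: struct_iso_def)
  have im: "f ` univ M = univ N" "f ` univ M = univ N'"
    using f g by (auto simp: struct_iso_def bij_betw_def)
  then show "univ N = univ N'" by simp
  have *: "\<exists>x \<in> I \<rightarrow>\<^sub>E univ M. y = compose I f x" if "y \<in> I \<rightarrow>\<^sub>E univ N" for y and I :: "'b set"
    using that compose_inv_into_in[of y I f "univ M"] compose_inv_into_right[of y I f "univ M"] im
    by metis
  show "fint N s y = fint N' s y" if s: "s \<in> Funs \<tau>" and y: "y \<in> arity \<tau> s \<rightarrow>\<^sub>E univ N" for s y
    using *[OF y] f g s unfolding struct_iso_def by metis
  show "rint N s = rint N' s" if s: "s \<in> Rels \<tau>" for s
  proof -
    have "y \<in> rint N s \<longleftrightarrow> y \<in> rint N' s" if y: "y \<in> arity \<tau> s \<rightarrow>\<^sub>E univ N" for y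
      using *[OF y] f g s unfolding struct_iso_def by metis
    then show ?thesis
      using rint_subset[OF N s] rint_subset[OF N' s] im by (metis subsetD subsetI subset_antisym)
  qed
qed

text \<open>Transport of structure along an injection; \<open>inv_into\<close> carries an argument
  tuple back to \<open>M\<close> before the value is pushed forward.\<close>

definition image_struct ::
    "('s, 'i) vocabulary \<Rightarrow> ('a \<Rightarrow> 'a) \<Rightarrow> ('s, 'i, 'a) struct \<Rightarrow> ('s, 'i, 'a) struct" where
  "image_struct \<tau> f M =
     \<lparr>univ = f ` univ M,
      fint = (\<lambda>s. if s \<in> Funs \<tau>
                 then (\<lambda>y \<in> arity \<tau> s \<rightarrow>\<^sub>E f ` univ M.
                         f (fint M s (compose (arity \<tau> s) (inv_into (univ M) f) y)))
                 else (\<lambda>_. undefined)),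
      rint = (\<lambda>s. if s \<in> Rels \<tau> then compose (arity \<tau> s) f ` rint M s else {})\<rparr>"

lemma univ_image_struct: "univ (image_struct \<tau> f M) = f ` univ M"
  by (simp add: image_struct_def)

lemma struct_iso_image_struct:
  assumes M: "is_structure \<tau> M" and inj: "inj_on f (univ M)"
  shows "struct_iso \<tau> f M (image_struct \<tau> f M)"
proof -
  let ?N = "image_struct \<tau> f M"
  have "f (fint M s (compose (arity \<tau> s) (inv_into (univ M) f) y)) \<in> f ` univ M"
    if "s \<in> Funs \<tau>" "y \<in> arity \<tau> s \<rightarrow>\<^sub>E f ` univ M" for s y
    using fint_in_univ[OF M that(1) compose_inv_into_in[OF that(2)]] by simp
  moreover have "set_sized (f ` univ M)"
    using M set_sized_image by (auto simp: is_structure_def)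
  moreover have "compose (arity \<tau> s) f x \<in> arity \<tau> s \<rightarrow>\<^sub>E f ` univ M"
    if "s \<in> Rels \<tau>" "x \<in> rint M s" for s x
    using subsetD[OF rint_subset[OF M that(1)] that(2)] by (rule compose_in_PiE) simp
  ultimately have N: "is_structure \<tau> ?N"
    unfolding is_structure_def by (simp add: image_struct_def image_subset_iff)
  have "f (fint M s x) = fint ?N s (compose (arity \<tau> s) f x)"
    if "s \<in> Funs \<tau>" "x \<in> arity \<tau> s \<rightarrow>\<^sub>E univ M" for s x
    using that compose_inv_into_left[OF inj that(2)] compose_in_PiE[OF that(2), of f "f ` univ M"]
    by (simp add: image_struct_def)
  moreover have "x \<in> rint M s \<longleftrightarrow> compose (arity \<tau> s) f x \<in> rint ?N s"
    if s: "s \<in> Rels \<tau>" and x: "x \<in> arity \<tau> s \<rightarrow>\<^sub>E univ M" for s x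
  proof
    assume "compose (arity \<tau> s) f x \<in> rint ?N s"
    then obtain x' where "x' \<in> rint M s" "compose (arity \<tau> s) f x = compose (arity \<tau> s) f x'"
      using s by (auto simp: image_struct_def)
    then show "x \<in> rint M s"
      using compose_inj[OF inj x] rint_subset[OF M s] by (metis subsetD)
  qed (use s in \<open>auto simp: image_struct_def\<close>)
  ultimately show ?thesis
    using M N inj by (simp add: struct_iso_def bij_betw_def univ_image_struct)
qed

lemma struct_iso_substructure:
  assumes f: "struct_iso \<tau> f N N'" and M: "substructure \<tau> M N"
  shows "struct_iso \<tau> f M (image_struct \<tau> f M)"
proof (rule struct_iso_image_struct)
  show "is_structure \<tau> M" using M by (simp add: substructure_def)
  show "inj_on f (univ M)"
    using f substructure_subset[OF M] unfolding struct_iso_def bij_betw_def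
    by (blast intro: inj_on_subset)
qed

text \<open>A tuple has fewer than \<mu> coordinates, so \<mu>-directedness places it inside one
  member of \<open>D\<close>, where the interpretation is that of \<open>V\<close>. Hence a
  structure that extends all members and has the right universe must be the union.\<close>

lemma union_struct_eq:
  assumes ary: "ary_vocabulary \<mu> \<tau>"
    and D: "directed_system \<mu> r D"
    and r: "\<And>M N. M \<in> D \<Longrightarrow> N \<in> D \<Longrightarrow> (M, N) \<in> r \<Longrightarrow> univ M \<subseteq> univ N"
    and sub: "\<And>M. M \<in> D \<Longrightarrow> substructure \<tau> M V"
    and univ: "univ V = (\<Union>M \<in> D. univ M)"
    and V: "is_structure \<tau> V"
  shows "union_struct \<tau> D = V"
proof -
  have cover: "\<exists>M \<in> D. x \<in> arity \<tau> s \<rightarrow>\<^sub>E univ M"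
    if s: "s \<in> symbols \<tau>" and x: "x \<in> arity \<tau> s \<rightarrow>\<^sub>E univ V" for s x
  proof -
    have "\<forall>i \<in> arity \<tau> s. \<exists>M \<in> D. x i \<in> univ M"
      using x univ by (auto simp: PiE_def Pi_def)
    then obtain m where m: "\<And>i. i \<in> arity \<tau> s \<Longrightarrow> m i \<in> D \<and> x i \<in> univ (m i)"
      by metis
    have "|m ` arity \<tau> s| <o \<mu>"
      using ary s card_of_image ordLeq_ordLess_trans unfolding ary_vocabulary_def by blast
    then obtain N where N: "N \<in> D" "\<forall>M \<in> m ` arity \<tau> s. (M, N) \<in> r"
      using D m unfolding directed_system_def by (metis image_subsetI)
    have "x i \<in> univ N" if "i \<in> arity \<tau> s" for i
      using m[OF that] N r that by blast
    then show ?thesis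
      using N(1) x by (auto simp: PiE_def Pi_def)
  qed
  have agree: "fint M s x = fint V s x"
    if "M \<in> D" "s \<in> Funs \<tau>" "x \<in> arity \<tau> s \<rightarrow>\<^sub>E univ M" for M s x
    using sub[OF that(1)] that(2,3) by (simp add: substructure_def)
  have fint: "(THE y. \<exists>M \<in> D. x \<in> (arity \<tau> s \<rightarrow>\<^sub>E univ M) \<and> y = fint M s x) = fint V s x"
    if s: "s \<in> Funs \<tau>" and x: "x \<in> arity \<tau> s \<rightarrow>\<^sub>E univ V" for s x
  proof (rule the_equality)
    obtain M where "M \<in> D" "x \<in> arity \<tau> s \<rightarrow>\<^sub>E univ M"
      using cover[OF _ x] s by (auto simp: symbols_def)
    then show "\<exists>M \<in> D. x \<in> (arity \<tau> s \<rightarrow>\<^sub>E univ M) \<and> fint V s x = fint M s x"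
      using agree[OF _ s] by metis
    show "y = fint V s x" if "\<exists>M \<in> D. x \<in> (arity \<tau> s \<rightarrow>\<^sub>E univ M) \<and> y = fint M s x" for y
      using that agree[OF _ s] by metis
  qed
  have fint': "fint (union_struct \<tau> D) s = fint V s" for s
  proof (cases "s \<in> Funs \<tau>")
    case True
    then have "fint V s \<in> (arity \<tau> s \<rightarrow>\<^sub>E univ V) \<rightarrow>\<^sub>E univ V"
      using V by (auto simp: is_structure_def)
    then show ?thesis
      using True fint[OF True] univ by (auto simp: union_struct_def PiE_def extensional_def)
  next
    case False
    then show ?thesis using V by (auto simp: is_structure_def union_struct_def)
  qed
  have rint: "(\<Union>M \<in> D. rint M s) = rint V s" for s
  proof (cases "s \<in> Rels \<tau>")
    case True
    then have eq: "\<And>M. M \<in> D \<Longrightarrow> rint M s = rint V s \<inter> (arity \<tau> s \<rightarrow>\<^sub>E univ M)"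
      using sub by (auto simp: substructure_def)
    have "rint V s \<subseteq> (\<Union>M \<in> D. rint M s)"
    proof
      fix x assume x: "x \<in> rint V s"
      then obtain M where "M \<in> D" "x \<in> arity \<tau> s \<rightarrow>\<^sub>E univ M"
        using True cover[of s x] rint_subset[OF V True] by (metis UnI2 subsetD symbols_def)
      then show "x \<in> (\<Union>M \<in> D. rint M s)" using x eq by (metis IntI UN_I)
    qed
    then show ?thesis using eq by blast
  next
    case False
    then have "rint V s = {}" "\<And>M. M \<in> D \<Longrightarrow> rint M s = {}"
      using V sub by (auto simp: is_structure_def substructure_def)
    then show ?thesis by blast
  qed
  show ?thesis
    using fint' rint univ by (intro struct.equality) (simp_all add: union_struct_def)
qed


section \<open>Closures in pseudo-universal classes\<close>

text \<open>Cardinals are well-ordered by size, so the nonempty collection of candidates has a least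
  one and the choice in \<open>LS\<close> is made from a nonempty set.\<close>

lemma LST_cardinal_LS:
  assumes "LST_cardinal \<mu> K \<kappa>"
  shows "LST_cardinal \<mu> K (LS \<mu> K)"
proof -
  have "\<exists>\<kappa> \<in> {\<kappa>. LST_cardinal \<mu> K \<kappa>}. \<forall>\<kappa>' \<in> {\<kappa>. LST_cardinal \<mu> K \<kappa>}. \<kappa> \<le>o \<kappa>'"
  proof (rule exists_minim_Card_order)
    show "{\<kappa>. LST_cardinal \<mu> K \<kappa>} \<noteq> {}" using assms by blast
  qed (simp add: LST_cardinal_def)
  then have "\<exists>\<kappa>. LST_cardinal \<mu> K \<kappa> \<and> (\<forall>\<kappa>'. LST_cardinal \<mu> K \<kappa>' \<longrightarrow> \<kappa> \<le>o \<kappa>')"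
    by blast
  then show ?thesis
    unfolding LS_def by (rule someI2_ex) blast
qed

text \<open>An injection \<open>h\<close> of \<open>A\<close> into \<open>B\<close> acts
  coordinatewise on sequences and keeps their length.\<close>

lemma card_of_seqs_below_mono:
  assumes "|A| \<le>o |B|"
  shows "|seqs_below \<mu> A| \<le>o |seqs_below \<mu> B|"
proof -
  obtain h where h: "inj_on h A" "h ` A \<subseteq> B"
    using assms card_of_ordLeq by metis
  let ?f = "\<lambda>(a, x). (a, compose (underS \<mu> a) h x)"
  have "inj_on ?f (seqs_below \<mu> A)"
    using compose_inj[OF h(1)] unfolding seqs_below_def inj_on_def by (auto simp del: PiE_iff)
  moreover have "?f ` seqs_below \<mu> A \<subseteq> seqs_below \<mu> B"
    using compose_in_PiE[OF _ h(2)] unfolding seqs_below_def by (auto simp del: PiE_iff)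
  ultimately show ?thesis
    using card_of_ordLeq by blast
qed

text \<open>A well-order strictly below \<mu> is isomorphic to a proper initial segment of \<mu>.
  Thus arities of the form \<open>underS \<mu> a\<close> suffice to list every set of size below
  \<mu>, the least \<open>a\<close> giving the empty tuple.\<close>

lemma enumerate_below:
  assumes "Card_order \<mu>" "|B| <o \<mu>"
  shows "\<exists>a \<in> Field \<mu>. \<exists>x \<in> underS \<mu> a \<rightarrow>\<^sub>E B. x ` underS \<mu> a = B"
proof -
  have wo: "Well_order \<mu>" using assms(1) by (simp add: card_order_on_def)
  obtain a where a: "a \<in> Field \<mu>" "|B| =o Restr \<mu> (underS \<mu> a)"
    using assms(2) ordLess_iff_ordIso_Restr[OF wo card_of_Well_order] by blast
  \<comment> \<open>Reflexivity of \<mu> keeps every point of the segment in the field of the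
    restricted order.\<close>
  have "Field (Restr \<mu> (underS \<mu> a)) = underS \<mu> a"
    using wo by (intro Refl_Field_Restr2)
      (auto simp: underS_def Field_def well_order_on_def linear_order_on_def partial_order_on_def
        preorder_on_def)
  moreover obtain f where "bij_betw f (Field |B| ) (Field (Restr \<mu> (underS \<mu> a)))"
    using a(2) unfolding ordIso_def iso_def by blast
  ultimately have f: "bij_betw f B (underS \<mu> a)" by (simp add: Field_card_of)
  let ?x = "restrict (inv_into B f) (underS \<mu> a)"
  have "inv_into B f ` underS \<mu> a = B"
    using bij_betw_inv_into[OF f] by (simp add: bij_betw_def)
  then have "?x ` underS \<mu> a = B" and "?x \<in> underS \<mu> a \<rightarrow>\<^sub>E B" by auto
  then show ?thesis using a(1) by blast
qed

text \<open>Regularity makes unions of fewer than \<mu> small sets small; nonemptiness lets every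
  closure be listed by a map defined on all of \<open>Field \<kappa>\<close>.\<close>

locale pseudo_universal_AEC =
  fixes \<mu> :: "'i rel" and K :: "('s, 'i, 'a) aclass"
  assumes Cinfinite: "Cinfinite \<mu>" and regular: "regularCard \<mu>"
    and pseudo_universal: "pseudo_universal \<mu> K"
    and nonempty: "\<And>M. M \<in> Mod K \<Longrightarrow> univ M \<noteq> {}"
begin

abbreviation \<tau> where "\<tau> \<equiv> voc K"

abbreviation \<kappa> where "\<kappa> \<equiv> LS \<mu> K"

section \<open>Consequences of the axioms for the class\<close>

lemma Card_order: "Card_order \<mu>"
  using Cinfinite by simp

lemma LST: "LST_cardinal \<mu> K \<kappa>"
  using pseudo_universal LST_cardinal_LS by (auto simp: pseudo_universal_def mu_AEC_def)

lemma AEC: "abstract_class \<mu> K" "coherence K" "chain_axioms \<mu> K"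
  using pseudo_universal by (auto simp: pseudo_universal_def mu_AEC_def)

lemma ary: "ary_vocabulary \<mu> \<tau>"
  using AEC(1) by (simp add: abstract_class_def)

lemma Mod_structure: "M \<in> Mod K \<Longrightarrow> is_structure \<tau> M"
  using AEC(1) by (simp add: abstract_class_def)

lemma Mod_iso: "M \<in> Mod K \<Longrightarrow> struct_iso \<tau> f M N \<Longrightarrow> N \<in> Mod K"
  using AEC(1) unfolding abstract_class_def closed_under_iso_def by blast

lemma le_Mod:
  assumes "(M, N) \<in> le K"
  shows "M \<in> Mod K" "N \<in> Mod K"
  using AEC(1) assms
  by (auto simp: abstract_class_def partial_order_on_def preorder_on_def)

lemma le_refl: "M \<in> Mod K \<Longrightarrow> (M, M) \<in> le K"
  using AEC(1) by (auto simp: abstract_class_def partial_order_on_def preorder_on_def refl_on_def)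

lemma le_trans: "(M, N) \<in> le K \<Longrightarrow> (N, P) \<in> le K \<Longrightarrow> (M, P) \<in> le K"
  using AEC(1) unfolding abstract_class_def partial_order_on_def preorder_on_def
  by (blast dest: transD)

lemma le_iso:
  "(M, N) \<in> le K \<Longrightarrow> struct_iso \<tau> f N N' \<Longrightarrow> struct_iso \<tau> f M M' \<Longrightarrow> (M', N') \<in> le K"
  using AEC(1) unfolding abstract_class_def by blast

lemma le_substructure: "(M, N) \<in> le K \<Longrightarrow> substructure \<tau> M N"
  using AEC(1) unfolding abstract_class_def by blast

lemma le_subset: "(M, N) \<in> le K \<Longrightarrow> univ M \<subseteq> univ N"
  using le_substructure substructure_subset by blast

text \<open>The common extension \<open>N\<close> yields the substructure relation, and coherence
  upgrades it to \<open>le K\<close>; inside a fixed \<open>N\<close> the order thus reduces to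
  inclusion.\<close>

lemma le_within:
  assumes "(M, N) \<in> le K" "(M', N) \<in> le K" "univ M \<subseteq> univ M'"
  shows "(M, M') \<in> le K"
proof -
  have "substructure \<tau> M M'"
    using assms le_substructure substructure_within by blast
  then show ?thesis
    using AEC(2) assms unfolding coherence_def by blast
qed

lemma le_univ_inj: "(M, N) \<in> le K \<Longrightarrow> (M', N) \<in> le K \<Longrightarrow> univ M = univ M' \<Longrightarrow> M = M'"
  using le_substructure substructure_univ_inj by blast

lemma cl_exists:
  assumes "N \<in> Mod K" "A \<subseteq> univ N"
  shows "\<exists>M. (M, N) \<in> le K \<and> univ M = cl K N A"
  using pseudo_universal assms by (simp add: pseudo_universal_def admits_intersections_def)

lemma embeddings_eq_on_cl:
  assumes "K_embedding K f M N" "K_embedding K g M N" "A \<subseteq> univ M"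
    and "\<And>x. x \<in> A \<Longrightarrow> f x = g x" and "x \<in> cl K M A"
  shows "f x = g x"
  using pseudo_universal assms unfolding pseudo_universal_def by blast

section \<open>The closure operator and its invariance\<close>

lemma cl_extensive: "A \<subseteq> cl K N A"
  by (auto simp: cl_def)

lemma cl_least: "(M, N) \<in> le K \<Longrightarrow> A \<subseteq> univ M \<Longrightarrow> cl K N A \<subseteq> univ M"
  by (auto simp: cl_def)

lemma cl_mono: "A \<subseteq> B \<Longrightarrow> cl K N A \<subseteq> cl K N B"
  unfolding cl_def by blast

text \<open>Structures competing in the intersection for \<open>M\<close> also compete in the one
  for \<open>N\<close>, by transitivity. Conversely, the closure in \<open>N\<close> lies inside
  \<open>M\<close>, so by coherence it competes in the intersection for \<open>M\<close>.\<close>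

lemma cl_le:
  assumes "(M, N) \<in> le K" "A \<subseteq> univ M"
  shows "cl K M A = cl K N A"
proof
  show "cl K N A \<subseteq> cl K M A"
    unfolding cl_def using le_trans[OF _ assms(1)] by blast
  obtain C where C: "(C, N) \<in> le K" "univ C = cl K N A"
    using cl_exists[of N A] assms le_subset le_Mod by blast
  then have "(C, M) \<in> le K"
    using le_within[OF C(1) assms(1)] cl_least[OF assms] by simp
  then show "cl K M A \<subseteq> cl K N A"
    using cl_least[of C M A] C(2) cl_extensive by metis
qed

definition cl_struct :: "('s, 'i, 'a) struct \<Rightarrow> 'a set \<Rightarrow> ('s, 'i, 'a) struct" where
  "cl_struct N A = (THE M. (M, N) \<in> le K \<and> univ M = cl K N A)"

lemma cl_struct_eqI: "(M, N) \<in> le K \<Longrightarrow> univ M = cl K N A \<Longrightarrow> cl_struct N A = M"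
  unfolding cl_struct_def using le_univ_inj by (intro the_equality) auto

lemma
  assumes "N \<in> Mod K" "A \<subseteq> univ N"
  shows cl_struct_le: "(cl_struct N A, N) \<in> le K"
    and univ_cl_struct: "univ (cl_struct N A) = cl K N A"
  using cl_exists[OF assms] cl_struct_eqI by auto

lemma cl_struct_le_eq:
  assumes "(M, N) \<in> le K" "A \<subseteq> univ M"
  shows "cl_struct M A = cl_struct N A"
proof -
  have M: "M \<in> Mod K" using assms le_Mod by blast
  have "(cl_struct M A, N) \<in> le K" "univ (cl_struct M A) = cl K N A"
    using cl_struct_le[OF M assms(2)] univ_cl_struct[OF M assms(2)] le_trans[OF _ assms(1)]
      cl_le[OF assms] by auto
  then show ?thesis using cl_struct_eqI by metis
qed

lemma le_image_struct:
  assumes "struct_iso \<tau> f N N'" "(M, N) \<in> le K"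
  shows "(image_struct \<tau> f M, N') \<in> le K"
  using le_iso[OF assms(2,1)] struct_iso_substructure[OF assms(1)] le_substructure[OF assms(2)]
  by blast

text \<open>The image of the closure is a K-substructure of \<open>N'\<close> containing the image
  of \<open>A\<close>, so it competes in the intersection defining the closure there.\<close>

lemma cl_iso_subset:
  assumes N: "N \<in> Mod K" and f: "struct_iso \<tau> f N N'" and A: "A \<subseteq> univ N"
  shows "cl K N' (f ` A) \<subseteq> f ` cl K N A"
proof -
  have "A \<subseteq> univ (cl_struct N A)"
    using univ_cl_struct[OF N A] cl_extensive by simp
  then have "cl K N' (f ` A) \<subseteq> univ (image_struct \<tau> f (cl_struct N A))"
    using le_image_struct[OF f cl_struct_le[OF N A]]
    by (intro cl_least) (auto simp: univ_image_struct)
  then show ?thesis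
    using univ_cl_struct[OF N A] by (simp add: univ_image_struct)
qed

lemma cl_subset: "N \<in> Mod K \<Longrightarrow> A \<subseteq> univ N \<Longrightarrow> cl K N A \<subseteq> univ N"
  using cl_least[OF le_refl] .

lemma cl_iso:
  assumes N: "N \<in> Mod K" and f: "struct_iso \<tau> f N N'" and A: "A \<subseteq> univ N"
  shows "cl K N' (f ` A) = f ` cl K N A"
proof
  let ?g = "inv_into (univ N) f"
  have inj: "inj_on f (univ N)" and im: "f ` univ N = univ N'"
    using f by (auto simp: struct_iso_def bij_betw_def)
  have fA: "f ` A \<subseteq> univ N'" using A im by blast
  have N': "N' \<in> Mod K" using Mod_iso[OF N f] .
  \<comment> \<open>The reverse inclusion is the one already known, applied to the inverse
    isomorphism and pushed forward by \<open>f\<close>.\<close>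
  have "?g ` f ` A = A"
    using inv_into_image_cancel[OF inj A] .
  then have "cl K N A \<subseteq> ?g ` cl K N' (f ` A)"
    using cl_iso_subset[OF N' struct_iso_inverse[OF f] fA] by simp
  then have "f ` cl K N A \<subseteq> f ` ?g ` cl K N' (f ` A)" by blast
  also have "\<dots> = cl K N' (f ` A)"
    using cl_subset[OF N' fA] im by (intro image_inv_into_cancel) auto
  finally show "f ` cl K N A \<subseteq> cl K N' (f ` A)" .
qed (rule cl_iso_subset[OF assms])

lemma cl_struct_iso:
  assumes N: "N \<in> Mod K" and f: "struct_iso \<tau> f N N'" and A: "A \<subseteq> univ N"
  shows "struct_iso \<tau> f (cl_struct N A) (cl_struct N' (f ` A))"
proof -
  have "cl_struct N' (f ` A) = image_struct \<tau> f (cl_struct N A)"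
    using le_image_struct[OF f cl_struct_le[OF N A]] cl_iso[OF assms] univ_cl_struct[OF N A]
    by (intro cl_struct_eqI) (auto simp: univ_image_struct)
  then show ?thesis
    using struct_iso_substructure[OF f le_substructure[OF cl_struct_le[OF N A]]] by simp
qed

text \<open>Closures of subsets of size below \<mu> form a \<mu>-directed system, as regularity
  keeps unions of fewer than \<mu> such subsets small. Its union is a K-substructure of
  \<open>N\<close> containing \<open>A\<close>, hence it contains the whole closure.\<close>

lemma cl_small_union:
  assumes N: "N \<in> Mod K" and A: "A \<subseteq> univ N" and b: "b \<in> cl K N A"
  shows "\<exists>B \<subseteq> A. |B| <o \<mu> \<and> b \<in> cl K N B"
proof -
  define \<B> where "\<B> = {B. B \<subseteq> A \<and> |B| <o \<mu>}"
  define D where "D = cl_struct N ` \<B>"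
  have le: "(cl_struct N B, N) \<in> le K" and univ: "univ (cl_struct N B) = cl K N B"
    if "B \<in> \<B>" for B
    using that A cl_struct_le[OF N] univ_cl_struct[OF N] by (auto simp: \<B>_def)
  have "\<exists>P \<in> D. \<forall>M \<in> S. (M, P) \<in> le K" if S: "S \<subseteq> D" "|S| <o \<mu>" for S
  proof -
    have "\<forall>M \<in> S. \<exists>B. B \<in> \<B> \<and> M = cl_struct N B"
      using S(1) unfolding D_def by blast
    then obtain c where c: "\<And>M. M \<in> S \<Longrightarrow> c M \<in> \<B> \<and> M = cl_struct N (c M)"
      by metis
    have "|\<Union>M \<in> S. c M| <o \<mu>"
      using c by (intro regularCard_UNION_bound[OF Cinfinite regular S(2)]) (auto simp: \<B>_def)
    moreover have "(\<Union>M \<in> S. c M) \<subseteq> A"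
      using c unfolding \<B>_def by blast
    ultimately have U: "(\<Union>M \<in> S. c M) \<in> \<B>"
      by (simp add: \<B>_def)
    have "(M, cl_struct N (\<Union>M \<in> S. c M)) \<in> le K" if M: "M \<in> S" for M
    proof -
      have "univ (cl_struct N (c M)) \<subseteq> univ (cl_struct N (\<Union>M \<in> S. c M))"
        using univ[OF U] univ[of "c M"] c[OF M] cl_mono[of "c M" "\<Union>M \<in> S. c M" N] M by auto
      then show ?thesis
        using le_within[OF le[of "c M"] le[OF U]] c[OF M] by auto
    qed
    then show ?thesis using U unfolding D_def by blast
  qed
  moreover have "(\<Union>M \<in> D. univ M) \<subseteq> univ N"
    using le le_subset unfolding D_def by blast
  then have "set_sized (\<Union>M \<in> D. univ M)"
    using Mod_structure[OF N] set_sized_subset by (auto simp: is_structure_def)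
  ultimately have dir: "directed_system \<mu> (le K) D"
    unfolding directed_system_def by blast
  moreover have "D \<subseteq> Mod K" and DN: "\<And>M. M \<in> D \<Longrightarrow> (M, N) \<in> le K"
    using le le_Mod unfolding D_def by blast+
  \<comment> \<open>The last clause of the chain axioms puts the union below the ambient
    \<open>N\<close> and so makes it a competitor for the closure.\<close>
  ultimately have "(union_struct \<tau> D, N) \<in> le K"
    using AEC(3) N unfolding chain_axioms_def by blast
  moreover have "A \<subseteq> univ (union_struct \<tau> D)"
  proof
    fix x assume x: "x \<in> A"
    \<comment> \<open>Singletons are small because \<mu> is infinite, and they already cover
      \<open>A\<close>.\<close>
    have "|{x}| <o \<mu>"
      using Cinfinite card_of_Card_order
      by (intro Cfinite_ordLess_Cinfinite) (auto simp: cfinite_def Field_card_of)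
    then have B: "{x} \<in> \<B>" using x by (simp add: \<B>_def)
    moreover have "x \<in> univ (cl_struct N {x})"
      using univ[OF B] cl_extensive[of "{x}" N] by simp
    ultimately show "x \<in> univ (union_struct \<tau> D)"
      by (auto simp: D_def union_struct_def)
  qed
  ultimately have "b \<in> univ (union_struct \<tau> D)"
    using b cl_least by blast
  then obtain B where "B \<in> \<B>" "b \<in> univ (cl_struct N B)"
    by (auto simp: D_def union_struct_def)
  then show ?thesis
    using univ unfolding \<B>_def by blast
qed

section \<open>Size of closures\<close>

lemma LS_bounds:
  shows "Card_order \<kappa>" "|symbols \<tau>| \<le>o \<kappa>" "\<mu> \<le>o \<kappa>" "Cinfinite \<kappa>"
proof -
  show co: "Card_order \<kappa>" using LST by (simp add: LST_cardinal_def)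
  have sum: "|symbols \<tau>| +c \<mu> \<le>o \<kappa>" using LST by (simp add: LST_cardinal_def)
  show "|symbols \<tau>| \<le>o \<kappa>"
    using ordLeq_csum1[of "|symbols \<tau>|" \<mu>] sum ordLeq_transitive card_of_Card_order by blast
  show le: "\<mu> \<le>o \<kappa>"
    using ordLeq_csum2[of \<mu> "|symbols \<tau>|"] sum ordLeq_transitive Card_order by blast
  show "Cinfinite \<kappa>"
    using cinfinite_mono[OF le] Cinfinite co by blast
qed

text \<open>The LST bound is |A|^{<\<mu>} + \<kappa>. From |A| < \<mu> \<le> \<kappa> and
  \<kappa>^{<\<mu>} = \<kappa> both summands are at most \<kappa>.\<close>

lemma card_cl_le_LS:
  assumes N: "N \<in> Mod K" and A: "A \<subseteq> univ N" and "|A| <o \<mu>"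
  shows "|cl K N A| \<le>o \<kappa>"
proof -
  obtain M where M: "(M, N) \<in> le K" "A \<subseteq> univ M" "|univ M| \<le>o |seqs_below \<mu> A| +c \<kappa>"
    using LST N A unfolding LST_cardinal_def by blast
  have "|A| \<le>o \<kappa>"
    using assms(3) LS_bounds(3) ordLess_imp_ordLeq ordLeq_transitive by blast
  then have "|A| \<le>o |Field \<kappa>|"
    using card_of_Field_ordIso[OF LS_bounds(1)] ordIso_symmetric ordLeq_ordIso_trans by blast
  then have "|seqs_below \<mu> A| \<le>o |seqs_below \<mu> (Field \<kappa>)|"
    by (rule card_of_seqs_below_mono)
  also have "|seqs_below \<mu> (Field \<kappa>)| =o \<kappa>"
    using LST ordIso_symmetric unfolding LST_cardinal_def by blast
  finally have "|seqs_below \<mu> A| +c \<kappa> \<le>o \<kappa>"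
    using LS_bounds ordLeq_refl by (intro csum_cinfinite_bound card_of_Card_order) auto
  moreover have "|cl K N A| \<le>o |univ M|"
    using cl_least[OF M(1,2)] by (rule card_of_mono1)
  ultimately show ?thesis
    using M(3) by (meson ordLeq_transitive)
qed


section \<open>Invariant enumeration of closures\<close>

text \<open>Isomorphism of structures with a distinguished tuple, from the pair of \<open>R\<close>
  and \<open>y\<close> to the pair of \<open>M\<close> and \<open>x\<close>.\<close>

definition tuple_iso ::
    "'i set \<Rightarrow> ('a \<Rightarrow> 'a) \<Rightarrow> ('s, 'i, 'a) struct \<Rightarrow> ('i \<Rightarrow> 'a) \<Rightarrow> ('s, 'i, 'a) struct \<Rightarrow> ('i \<Rightarrow> 'a) \<Rightarrow> bool"
  where "tuple_iso I f R y M x \<longleftrightarrow>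
    struct_iso \<tau> f R M \<and> y \<in> I \<rightarrow>\<^sub>E univ R \<and> compose I f y = x"

text \<open>The predicate under \<open>SOME\<close> depends only on the isomorphism type of the
  pair, so isomorphic pairs receive literally the same representative.\<close>

definition canonical ::
    "'i set \<Rightarrow> ('s, 'i, 'a) struct \<Rightarrow> ('i \<Rightarrow> 'a) \<Rightarrow> ('s, 'i, 'a) struct \<times> ('i \<Rightarrow> 'a)" where
  "canonical I M x = (SOME p. \<exists>f. tuple_iso I f (fst p) (snd p) M x)"

definition canonical_iso ::
    "'i set \<Rightarrow> ('s, 'i, 'a) struct \<Rightarrow> ('i \<Rightarrow> 'a) \<Rightarrow> 'a \<Rightarrow> 'a" where
  "canonical_iso I M x =
    (SOME f. tuple_iso I f (fst (canonical I M x)) (snd (canonical I M x)) M x)"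

text \<open>Repetitions are allowed, so that \<open>Field \<kappa>\<close> can index every nonempty
  universe of size at most \<kappa>.\<close>

definition listing :: "('s, 'i, 'a) struct \<Rightarrow> 'a \<Rightarrow> 'a" where
  "listing M = (SOME e. e ` Field \<kappa> = univ M)"

text \<open>The listing is chosen on the representative and only then carried to \<open>M\<close>; a
  listing chosen on each \<open>M\<close> separately would have no reason to respect
  isomorphisms.\<close>

definition elem :: "'i set \<Rightarrow> ('s, 'i, 'a) struct \<Rightarrow> ('i \<Rightarrow> 'a) \<Rightarrow> 'a \<Rightarrow> 'a" where
  "elem I M x \<xi> = canonical_iso I M x (listing (fst (canonical I M x)) \<xi>)"

text \<open>Closures of tuples, described without an ambient structure so that the notion is stable
  under isomorphism.\<close>

definition generated :: "'i set \<Rightarrow> ('s, 'i, 'a) struct \<Rightarrow> ('i \<Rightarrow> 'a) \<Rightarrow> bool" where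
  "generated I M x \<longleftrightarrow> M \<in> Mod K \<and> x \<in> I \<rightarrow>\<^sub>E univ M \<and> cl K M (x ` I) = univ M \<and> |univ M| \<le>o \<kappa>"

text \<open>A nonempty set is the image of any set at least as large; here the exclusion of the
  empty structure enters.\<close>

lemma listing_image:
  assumes "M \<in> Mod K" "|univ M| \<le>o \<kappa>"
  shows "listing M ` Field \<kappa> = univ M"
proof -
  have "|univ M| \<le>o |Field \<kappa>|"
    using assms(2) card_of_Field_ordIso[OF LS_bounds(1)] ordIso_symmetric ordLeq_ordIso_trans
    by blast
  then have "\<exists>e. e ` Field \<kappa> = univ M"
    using card_of_ordLeq2[OF nonempty[OF assms(1)]] by blast
  then show ?thesis
    unfolding listing_def by (rule someI_ex)
qed

section \<open>Rigidity of generated pairs and transfer of the listing\<close>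

lemma tuple_iso_image: "tuple_iso I f R y M x \<Longrightarrow> x ` I = f ` y ` I"
  by (force simp: tuple_iso_def compose_def)

lemma tuple_iso_canonical:
  assumes "generated I M x"
  shows "tuple_iso I (canonical_iso I M x) (fst (canonical I M x)) (snd (canonical I M x)) M x"
proof -
  have M: "M \<in> Mod K" and x: "x \<in> I \<rightarrow>\<^sub>E univ M"
    using assms unfolding generated_def by blast+
  have "compose (arity \<tau> s) id y = y" if "y \<in> arity \<tau> s \<rightarrow>\<^sub>E univ M" for s y
    using that by (rule compose_ident_on) simp
  then have "struct_iso \<tau> id M M"
    using Mod_structure[OF M] unfolding struct_iso_def by simp
  then have "tuple_iso I id M x M x"
    using x compose_ident_on[OF x, of id] by (simp add: tuple_iso_def)
  then have "\<exists>p f. tuple_iso I f (fst p) (snd p) M x"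
    by (metis fst_conv snd_conv)
  then have "\<exists>f. tuple_iso I f (fst (canonical I M x)) (snd (canonical I M x)) M x"
    unfolding canonical_def by (rule someI_ex)
  then show ?thesis
    unfolding canonical_iso_def by (rule someI_ex)
qed

text \<open>Closure commutes with isomorphisms, so the closure of \<open>y\<close> and the whole of
  \<open>univ R\<close> have the same image under the injective \<open>f\<close>.\<close>

lemma generated_iso_source:
  assumes g: "generated I M x" and f: "tuple_iso I f R y M x"
  shows "generated I R y"
proof -
  have M: "M \<in> Mod K" and x: "x \<in> I \<rightarrow>\<^sub>E univ M" and cl: "cl K M (x ` I) = univ M"
    and card: "|univ M| \<le>o \<kappa>"
    using g unfolding generated_def by blast+
  have iso: "struct_iso \<tau> f R M" and y: "y \<in> I \<rightarrow>\<^sub>E univ R"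
    using f unfolding tuple_iso_def by blast+
  have R: "R \<in> Mod K"
    using Mod_iso[OF M struct_iso_inverse[OF iso]] .
  have bij: "bij_betw f (univ R) (univ M)"
    using iso unfolding struct_iso_def by blast
  have yI: "y ` I \<subseteq> univ R" using y PiE_mem by blast
  have "f ` cl K R (y ` I) = f ` univ R"
    using cl_iso[OF R iso yI] tuple_iso_image[OF f] cl bij by (simp add: bij_betw_def)
  then have "cl K R (y ` I) = univ R"
    using bij cl_subset[OF R yI] inj_on_image_eq_iff[of f "univ R"]
    by (metis bij_betw_def order_refl)
  moreover have "|univ R| \<le>o \<kappa>"
    using bij card card_of_ordIsoI ordIso_ordLeq_trans by blast
  ultimately show ?thesis
    using R y unfolding generated_def by blast
qed

lemma generated_iso_target:
  assumes g: "generated I M x" and f: "struct_iso \<tau> f M N"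
  shows "generated I N (compose I f x)"
proof -
  have M: "M \<in> Mod K" and x: "x \<in> I \<rightarrow>\<^sub>E univ M" and cl: "cl K M (x ` I) = univ M"
    and card: "|univ M| \<le>o \<kappa>"
    using g unfolding generated_def by blast+
  have im: "f ` univ M = univ N"
    using f by (auto simp: struct_iso_def bij_betw_def)
  have "compose I f x ` I = f ` x ` I" by (force simp: compose_def)
  then have "cl K N (compose I f x ` I) = univ N"
    using cl_iso[OF M f, of "x ` I"] x cl im PiE_mem by (metis image_subsetI)
  moreover have "|univ N| \<le>o \<kappa>"
    using card_of_image[of f "univ M"] card im ordLeq_transitive by metis
  moreover have "compose I f x \<in> I \<rightarrow>\<^sub>E univ N"
    using x im by (intro compose_in_PiE) auto
  ultimately show ?thesis
    using Mod_iso[OF M f] unfolding generated_def by blast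
qed

text \<open>Pseudo-universality acts as rigidity: both maps are embeddings that agree on the entries
  of \<open>y\<close>, and the closure of these entries is all of \<open>R\<close>.\<close>

lemma tuple_iso_unique:
  assumes g: "generated I M x" and f: "tuple_iso I f R y M x" and f': "tuple_iso I f' R y M x"
    and u: "u \<in> univ R"
  shows "f u = f' u"
proof (rule embeddings_eq_on_cl[of f R M f' "y ` I" u])
  have M: "M \<in> Mod K" using g unfolding generated_def by blast
  have R: "R \<in> Mod K" and y: "y \<in> I \<rightarrow>\<^sub>E univ R" and cl: "cl K R (y ` I) = univ R"
    using generated_iso_source[OF g f] unfolding generated_def by blast+
  \<comment> \<open>Both maps are onto \<open>M\<close>, so reflexivity of \<open>le K\<close> turns
    the isomorphisms into embeddings.\<close>
  show "K_embedding K f R M" "K_embedding K f' R M"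
    using f f' M R le_refl[OF M] unfolding K_embedding_def tuple_iso_def by blast+
  show "y ` I \<subseteq> univ R" using y PiE_mem by blast
  show "u \<in> cl K R (y ` I)" using cl u by simp
  show "f v = f' v" if v: "v \<in> y ` I" for v
  proof -
    obtain i where i: "i \<in> I" "v = y i" using v by blast
    have "compose I f y i = compose I f' y i"
      using f f' unfolding tuple_iso_def by simp
    then show ?thesis using i by (simp add: compose_def)
  qed
qed

lemma elem_image:
  assumes "generated I M x"
  shows "elem I M x ` Field \<kappa> = univ M"
proof -
  let ?R = "fst (canonical I M x)" and ?f = "canonical_iso I M x"
  have f: "tuple_iso I ?f ?R (snd (canonical I M x)) M x"
    using tuple_iso_canonical[OF assms] .
  have "listing ?R ` Field \<kappa> = univ ?R"
    using generated_iso_source[OF assms f] listing_image unfolding generated_def by blast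
  moreover have "?f ` univ ?R = univ M"
    using f by (auto simp: tuple_iso_def struct_iso_def bij_betw_def)
  moreover have "elem I M x ` Field \<kappa> = ?f ` listing ?R ` Field \<kappa>"
    unfolding elem_def by blast
  ultimately show ?thesis by simp
qed

text \<open>Both pairs share a representative. The chosen isomorphism to \<open>M\<close> followed
  by \<open>g\<close>, and the chosen isomorphism to \<open>N\<close>, agree on it by
  rigidity.\<close>

lemma elem_iso:
  assumes gen: "generated I M x" and g: "struct_iso \<tau> g M N" and \<xi>: "\<xi> \<in> Field \<kappa>"
  shows "elem I N (compose I g x) \<xi> = g (elem I M x \<xi>)"
proof -
  let ?x' = "compose I g x"
  have gen': "generated I N ?x'"
    using generated_iso_target[OF gen g] .
  have x: "x \<in> I \<rightarrow>\<^sub>E univ M" using gen unfolding generated_def by blast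
  have inj: "inj_on g (univ M)" using g by (auto simp: struct_iso_def bij_betw_def)
  \<comment> \<open>Composing with \<open>g\<close> and with its inverse shows that exactly the same
    pairs are isomorphic to either side, so the choices in \<open>canonical\<close>
    coincide.\<close>
  have push: "tuple_iso I (g \<circ> f) R y N ?x'" if "tuple_iso I f R y M x" for f R y
    using that struct_iso_compose[OF _ g] unfolding tuple_iso_def
    by (auto simp: compose_compose[symmetric] simp del: PiE_iff)
  have pull: "tuple_iso I (inv_into (univ M) g \<circ> f) R y M x" if "tuple_iso I f R y N ?x'" for f R y
    using that struct_iso_compose[OF _ struct_iso_inverse[OF g]] compose_inv_into_left[OF inj x]
    unfolding tuple_iso_def by (simp add: compose_compose[symmetric])
  have "(\<lambda>p. \<exists>f. tuple_iso I f (fst p) (snd p) N ?x') = (\<lambda>p. \<exists>f. tuple_iso I f (fst p) (snd p) M x)"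
    using push pull by blast
  then have canon: "canonical I N ?x' = canonical I M x"
    unfolding canonical_def by simp
  let ?R = "fst (canonical I M x)" and ?y = "snd (canonical I M x)"
  have f: "tuple_iso I (canonical_iso I M x) ?R ?y M x"
    using tuple_iso_canonical[OF gen] .
  have f': "tuple_iso I (canonical_iso I N ?x') ?R ?y N ?x'"
    using tuple_iso_canonical[OF gen'] canon by simp
  \<comment> \<open>Rigidity gives agreement on \<open>univ ?R\<close> only, hence the check that
    the listed element lies there.\<close>
  have "listing ?R \<xi> \<in> univ ?R"
    using generated_iso_source[OF gen f] listing_image \<xi> unfolding generated_def by blast
  then show ?thesis
    using tuple_iso_unique[OF gen' f' push[OF f]] canon by (simp add: elem_def)
qed

section \<open>Operations naming the elements of closures\<close>

definition gen_op :: "'i \<Rightarrow> 'a \<Rightarrow> ('s, 'i, 'a) struct \<Rightarrow> ('i \<Rightarrow> 'a) \<Rightarrow> 'a" where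
  "gen_op a \<xi> N x = elem (underS \<mu> a) (cl_struct N (x ` underS \<mu> a)) x \<xi>"

lemma PiE_image_subset: "x \<in> I \<rightarrow>\<^sub>E U \<Longrightarrow> x ` I \<subseteq> U"
  by (auto dest: PiE_mem)

lemma generated_cl_struct:
  assumes N: "N \<in> Mod K" and a: "a \<in> Field \<mu>" and x: "x \<in> underS \<mu> a \<rightarrow>\<^sub>E univ N"
  shows "generated (underS \<mu> a) (cl_struct N (x ` underS \<mu> a)) x"
proof -
  let ?I = "underS \<mu> a" let ?A = "x ` ?I" let ?C = "cl_struct N ?A"
  have A: "?A \<subseteq> univ N" using x by (rule PiE_image_subset)
  note le = cl_struct_le[OF N A] and univ = univ_cl_struct[OF N A]
  have "|?A| <o \<mu>"
    using card_of_underS[OF Card_order a] card_of_image ordLeq_ordLess_trans by blast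
  then have "|univ ?C| \<le>o \<kappa>"
    using card_cl_le_LS[OF N A] univ by simp
  moreover have AC: "?A \<subseteq> univ ?C" using univ cl_extensive by simp
  then have "x \<in> ?I \<rightarrow>\<^sub>E univ ?C"
    using x by (auto simp: PiE_def)
  moreover have "cl K ?C ?A = univ ?C"
    using cl_le[OF le AC] univ by simp
  ultimately show ?thesis
    using le_Mod(1)[OF le] unfolding generated_def by blast
qed

lemma gen_op_image:
  assumes N: "N \<in> Mod K" and a: "a \<in> Field \<mu>" and x: "x \<in> underS \<mu> a \<rightarrow>\<^sub>E univ N"
  shows "(\<lambda>\<xi>. gen_op a \<xi> N x) ` Field \<kappa> = cl K N (x ` underS \<mu> a)"
  using elem_image[OF generated_cl_struct[OF assms]] univ_cl_struct[OF N PiE_image_subset[OF x]]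
  unfolding gen_op_def by simp

lemma gen_op_in_univ:
  assumes "N \<in> Mod K" "a \<in> Field \<mu>" "\<xi> \<in> Field \<kappa>" "x \<in> underS \<mu> a \<rightarrow>\<^sub>E univ N"
  shows "gen_op a \<xi> N x \<in> univ N"
  using gen_op_image[OF assms(1,2,4)] cl_subset[OF assms(1) PiE_image_subset[OF assms(4)]] assms(3)
  by blast

lemma gen_op_iso:
  assumes N: "N \<in> Mod K" and a: "a \<in> Field \<mu>" and \<xi>: "\<xi> \<in> Field \<kappa>"
    and x: "x \<in> underS \<mu> a \<rightarrow>\<^sub>E univ N" and f: "struct_iso \<tau> f N N'"
  shows "f (gen_op a \<xi> N x) = gen_op a \<xi> N' (compose (underS \<mu> a) f x)"
proof -
  have "compose (underS \<mu> a) f x ` underS \<mu> a = f ` x ` underS \<mu> a"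
    by (force simp: compose_def)
  then show ?thesis
    unfolding gen_op_def
    using elem_iso[OF generated_cl_struct[OF N a x]
        cl_struct_iso[OF N f PiE_image_subset[OF x]] \<xi>] by simp
qed

text \<open>The closure of a tuple is the same structure computed in \<open>M\<close> and in
  \<open>N\<close>, so both sides are the same value of \<open>elem\<close>.\<close>

lemma gen_op_le:
  assumes "(M, N) \<in> le K" "x \<in> underS \<mu> a \<rightarrow>\<^sub>E univ M"
  shows "gen_op a \<xi> M x = gen_op a \<xi> N x"
  unfolding gen_op_def using cl_struct_le_eq[OF assms(1) PiE_image_subset[OF assms(2)]] by simp


section \<open>The expansion\<close>

text \<open>An arbitrary injection of the index pairs (length, position) into the type that holds
  the new symbols.\<close>

definition code :: "'i \<times> 'a \<Rightarrow> 'a set" where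
  "code = (SOME h. inj_on h (Field \<mu> \<times> Field \<kappa>))"

definition decode :: "'a set \<Rightarrow> 'i \<times> 'a" where
  "decode = inv_into (Field \<mu> \<times> Field \<kappa>) code"

text \<open>The symbol coded by (a, \<xi>) takes tuples indexed by the segment below
  \<open>a\<close>. For the least \<open>a\<close> it is a constant, which rules out an empty
  substructure.\<close>

definition exp_voc :: "('s + 'a set, 'i) vocabulary" where
  "exp_voc =
     \<lparr>Funs = Inl ` Funs \<tau> \<union> Inr ` code ` (Field \<mu> \<times> Field \<kappa>),
      Rels = Inl ` Rels \<tau>,
      arity = case_sum (arity \<tau>) (\<lambda>c. underS \<mu> (fst (decode c)))\<rparr>"

definition expand :: "('s, 'i, 'a) struct \<Rightarrow> ('s + 'a set, 'i, 'a) struct" where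
  "expand N =
     \<lparr>univ = univ N,
      fint = case_sum (fint N)
        (\<lambda>c. if c \<in> code ` (Field \<mu> \<times> Field \<kappa>)
             then (\<lambda>x \<in> underS \<mu> (fst (decode c)) \<rightarrow>\<^sub>E univ N. gen_op (fst (decode c)) (snd (decode c)) N x)
             else (\<lambda>_. undefined)),
      rint = case_sum (rint N) (\<lambda>_. {})\<rparr>"

definition exp_class :: "('s + 'a set, 'i, 'a) aclass" where
  "exp_class =
     \<lparr>voc = exp_voc, Mod = expand ` Mod K,
      le = {(M, N). M \<in> expand ` Mod K \<and> N \<in> expand ` Mod K \<and> substructure exp_voc M N}\<rparr>"

lemma card_of_index: "|Field \<mu> \<times> Field \<kappa>| \<le>o \<kappa>"
proof (rule card_of_Times_ordLeq_infinite_Field)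
  show "infinite (Field \<kappa>)" using LS_bounds(4) by (simp add: cinfinite_def)
  show "|Field \<mu>| \<le>o \<kappa>"
    using card_of_Field_ordIso[OF Card_order] LS_bounds(3) ordIso_ordLeq_trans by blast
  show "|Field \<kappa>| \<le>o \<kappa>"
    using card_of_Field_ordIso[OF LS_bounds(1)] ordIso_iff_ordLeq by blast
qed (rule LS_bounds(1))

lemma inj_code: "inj_on code (Field \<mu> \<times> Field \<kappa>)"
proof -
  have "|Field \<mu> \<times> Field \<kappa>| \<le>o |Field \<kappa>|"
    using card_of_index card_of_Field_ordIso[OF LS_bounds(1)] ordIso_symmetric ordLeq_ordIso_trans
    by blast
  then obtain h :: "'i \<times> 'a \<Rightarrow> 'a" where "inj_on h (Field \<mu> \<times> Field \<kappa>)"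
    using card_of_ordLeq by metis
  \<comment> \<open>Singletons lift an injection into \<open>'a\<close> to one into
    \<open>'a set\<close>.\<close>
  then have "inj_on (\<lambda>p. {h p}) (Field \<mu> \<times> Field \<kappa>)"
    by (auto simp: inj_on_def)
  then show ?thesis
    unfolding code_def by (rule someI[where P = "\<lambda>h. inj_on h (Field \<mu> \<times> Field \<kappa>)"])
qed

lemma decode_code: "a \<in> Field \<mu> \<Longrightarrow> \<xi> \<in> Field \<kappa> \<Longrightarrow> decode (code (a, \<xi>)) = (a, \<xi>)"
  unfolding decode_def using inj_code by (simp add: inv_into_f_f)

lemma ball_Funs_exp_voc:
  "(\<forall>s \<in> Funs exp_voc. P s) \<longleftrightarrow>
    (\<forall>s \<in> Funs \<tau>. P (Inl s)) \<and> (\<forall>a \<in> Field \<mu>. \<forall>\<xi> \<in> Field \<kappa>. P (Inr (code (a, \<xi>))))"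
  by (auto simp: exp_voc_def)

lemma ball_Rels_exp_voc: "(\<forall>s \<in> Rels exp_voc. P s) \<longleftrightarrow> (\<forall>s \<in> Rels \<tau>. P (Inl s))"
  by (auto simp: exp_voc_def)

lemma arity_exp_voc:
  "arity exp_voc (Inl s) = arity \<tau> s"
  "a \<in> Field \<mu> \<Longrightarrow> \<xi> \<in> Field \<kappa> \<Longrightarrow> arity exp_voc (Inr (code (a, \<xi>))) = underS \<mu> a"
  by (simp_all add: exp_voc_def decode_code)

lemma expand_sel:
  "univ (expand N) = univ N"
  "fint (expand N) (Inl s) = fint N s"
  "rint (expand N) (Inl s) = rint N s"
  by (simp_all add: expand_def)

lemma fint_expand_code:
  "a \<in> Field \<mu> \<Longrightarrow> \<xi> \<in> Field \<kappa> \<Longrightarrow>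
    fint (expand N) (Inr (code (a, \<xi>))) = (\<lambda>x \<in> underS \<mu> a \<rightarrow>\<^sub>E univ N. gen_op a \<xi> N x)"
  by (auto simp: expand_def decode_code)

lemmas exp_simps = ball_Funs_exp_voc ball_Rels_exp_voc arity_exp_voc expand_sel fint_expand_code

lemma ary_exp_voc: "ary_vocabulary \<mu> exp_voc"
proof -
  have "Funs exp_voc \<inter> Rels exp_voc = {}"
    using ary by (auto simp: exp_voc_def ary_vocabulary_def)
  moreover have "\<forall>s \<in> Funs exp_voc. |arity exp_voc s| <o \<mu>"
    using ary card_of_underS[OF Card_order]
    by (simp add: exp_simps ary_vocabulary_def symbols_def)
  moreover have "\<forall>s \<in> Rels exp_voc. |arity exp_voc s| <o \<mu>"
    using ary by (simp add: exp_simps ary_vocabulary_def symbols_def)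
  ultimately show ?thesis
    unfolding ary_vocabulary_def symbols_def by blast
qed

lemma exp_voc_extends: "vocabulary_extends exp_voc \<tau>"
  by (auto simp: vocabulary_extends_def exp_voc_def)

text \<open>There are at most \<kappa> old symbols by the LST axiom and at most \<mu> times \<kappa>
  new ones, so \<kappa> bounds the total; Cantor's theorem compares \<kappa> with its power.\<close>

lemma card_symbols_exp_voc: "|symbols exp_voc| \<le>o ctwo ^c \<kappa>"
proof -
  have "|Inr ` code ` (Field \<mu> \<times> Field \<kappa>) :: ('s + 'a set) set| \<le>o \<kappa>"
    using card_of_image[of "Inr \<circ> code" "Field \<mu> \<times> Field \<kappa>"] card_of_index
    unfolding image_comp by (rule ordLeq_transitive)
  moreover have "|Inl ` symbols \<tau> :: ('s + 'a set) set| \<le>o \<kappa>"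
    using card_of_image LS_bounds(2) by (rule ordLeq_transitive)
  ultimately have "|Inl ` symbols \<tau> \<union> Inr ` code ` (Field \<mu> \<times> Field \<kappa>)| \<le>o \<kappa>"
    using LS_bounds(1,4) by (intro card_of_Un_ordLeq_infinite_Field) (auto simp: cinfinite_def)
  moreover have "symbols exp_voc = Inl ` symbols \<tau> \<union> Inr ` code ` (Field \<mu> \<times> Field \<kappa>)"
    by (auto simp: symbols_def exp_voc_def)
  ultimately have "|symbols exp_voc| \<le>o \<kappa>" by simp
  then show ?thesis
    using ordLess_imp_ordLeq[OF ordLess_ctwo_cexp[OF LS_bounds(1)]] by (rule ordLeq_transitive)
qed

section \<open>Expansions against reducts\<close>

lemma is_structure_expand:
  assumes N: "N \<in> Mod K"
  shows "is_structure exp_voc (expand N)"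
  unfolding is_structure_def
proof (intro conjI)
  have st: "is_structure \<tau> N" using Mod_structure[OF N] .
  show "set_sized (univ (expand N))"
    using st by (simp add: exp_simps is_structure_def)
  show "\<forall>s \<in> Funs exp_voc. fint (expand N) s \<in>
      (arity exp_voc s \<rightarrow>\<^sub>E univ (expand N)) \<rightarrow>\<^sub>E univ (expand N)"
    using st gen_op_in_univ[OF N] by (simp add: exp_simps is_structure_def)
  show "\<forall>s \<in> Rels exp_voc. rint (expand N) s \<subseteq> arity exp_voc s \<rightarrow>\<^sub>E univ (expand N)"
    using st by (simp add: exp_simps is_structure_def)
  have "\<And>s. s \<notin> Funs \<tau> \<Longrightarrow> fint N s = (\<lambda>_. undefined)" "\<And>s. s \<notin> Rels \<tau> \<Longrightarrow> rint N s = {}"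
    using st by (simp_all add: is_structure_def)
  then show "\<forall>s. s \<notin> Funs exp_voc \<longrightarrow> fint (expand N) s = (\<lambda>_. undefined)"
    and "\<forall>s. s \<notin> Rels exp_voc \<longrightarrow> rint (expand N) s = {}"
    by (auto simp: expand_def exp_voc_def split: sum.split)
qed

lemma reduct_expand:
  assumes N: "N \<in> Mod K"
  shows "reduct \<tau> (expand N) = N"
  using Mod_structure[OF N] by (intro struct.equality ext)
    (simp_all add: reduct_def expand_sel is_structure_def)

lemma univ_reduct: "univ (reduct \<tau> M) = univ M"
  by (simp add: reduct_def)

lemma is_structure_reduct:
  "is_structure exp_voc M \<Longrightarrow> is_structure \<tau> (reduct \<tau> M)"
  by (simp add: is_structure_def exp_simps reduct_def)

lemma substructure_reduct:
  "substructure exp_voc M N \<Longrightarrow> substructure \<tau> (reduct \<tau> M) (reduct \<tau> N)"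
  by (simp add: substructure_def is_structure_reduct) (simp add: exp_simps reduct_def)

lemma struct_iso_reduct:
  "struct_iso exp_voc f M N \<Longrightarrow> struct_iso \<tau> f (reduct \<tau> M) (reduct \<tau> N)"
  by (simp add: struct_iso_def is_structure_reduct) (simp add: exp_simps reduct_def)

lemma struct_iso_expand:
  assumes M: "M \<in> Mod K" and f: "struct_iso \<tau> f M N"
  shows "struct_iso exp_voc f (expand M) (expand N)"
proof -
  have N: "N \<in> Mod K" using Mod_iso[OF M f] .
  have "compose (underS \<mu> a) f x \<in> underS \<mu> a \<rightarrow>\<^sub>E univ N"
    if "x \<in> underS \<mu> a \<rightarrow>\<^sub>E univ M" for x a
    using that f by (intro compose_in_PiE) (auto simp: struct_iso_def bij_betw_def)
  then show ?thesis
    using f is_structure_expand[OF M] is_structure_expand[OF N] gen_op_iso[OF M _ _ _ f]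
    unfolding struct_iso_def exp_simps
    by (simp add: arity_exp_voc expand_sel fint_expand_code)
qed

lemma substructure_expand:
  assumes "(M, N) \<in> le K"
  shows "substructure exp_voc (expand M) (expand N)"
proof -
  have "x \<in> underS \<mu> a \<rightarrow>\<^sub>E univ N" if "x \<in> underS \<mu> a \<rightarrow>\<^sub>E univ M" for x a
    using le_subset[OF assms] that by (rule PiE_mono_set)
  then show ?thesis
    using le_substructure[OF assms] is_structure_expand[OF le_Mod(1)[OF assms]]
      is_structure_expand[OF le_Mod(2)[OF assms]] gen_op_le[OF assms]
    unfolding substructure_def exp_simps
    by (simp add: arity_exp_voc expand_sel fint_expand_code)
qed

text \<open>Being closed under the new operations makes \<open>univ M\<close> equal to its own
  closure in \<open>N\<close>, and a closure carries a K-substructure. Uniqueness of the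
  substructure on a given universe then identifies \<open>M\<close> and its reduct.\<close>

lemma substructure_of_expand:
  assumes N: "N \<in> Mod K" and M: "substructure exp_voc M (expand N)"
  shows "(reduct \<tau> M, N) \<in> le K" and "M = expand (reduct \<tau> M)"
proof -
  have sub: "univ M \<subseteq> univ N"
    using substructure_subset[OF M] by (simp add: expand_sel)
  have "cl K N (univ M) \<subseteq> univ M"
  proof
    fix b assume "b \<in> cl K N (univ M)"
    then obtain B where B: "B \<subseteq> univ M" "|B| <o \<mu>" "b \<in> cl K N B"
      using cl_small_union[OF N sub] by blast
    \<comment> \<open>The small set becomes a tuple over an initial segment of \<mu>, the form of
      argument that the new symbols take.\<close>
    obtain a x where a: "a \<in> Field \<mu>" and x: "x \<in> underS \<mu> a \<rightarrow>\<^sub>E B" "x ` underS \<mu> a = B"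
      using enumerate_below[OF Card_order B(2)] by blast
    have xM: "x \<in> underS \<mu> a \<rightarrow>\<^sub>E univ M" and xN: "x \<in> underS \<mu> a \<rightarrow>\<^sub>E univ N"
      using PiE_mono_set[OF _ x(1)] B(1) sub by blast+
    \<comment> \<open>For fixed \<open>x\<close> the operations run through the whole closure of
      \<open>B\<close>, so \<open>b\<close> is one of their values.\<close>
    obtain \<xi> where \<xi>: "\<xi> \<in> Field \<kappa>" "b = gen_op a \<xi> N x"
      using gen_op_image[OF N a xN] B(3) x(2) by blast
    let ?s = "Inr (code (a, \<xi>))"
    have s: "?s \<in> Funs exp_voc" using a \<xi>(1) by (simp add: exp_voc_def)
    have xs: "x \<in> arity exp_voc ?s \<rightarrow>\<^sub>E univ M"
      using xM a \<xi>(1) by (simp add: arity_exp_voc)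
    have "fint M ?s x = fint (expand N) ?s x"
      using M s xs unfolding substructure_def by blast
    also have "\<dots> = b"
      using a \<xi> xN by (simp add: fint_expand_code)
    finally show "b \<in> univ M"
      using fint_in_univ[OF _ s xs] M unfolding substructure_def by simp
  qed
  then have cl: "cl K N (univ M) = univ M"
    using cl_extensive by blast
  \<comment> \<open>The reduct of \<open>M\<close> is not yet known to lie in \<open>Mod K\<close>;
    \<open>C\<close> is the member of the class on the same universe.\<close>
  obtain C where C: "(C, N) \<in> le K" "univ C = univ M"
    using cl_exists[OF N sub] cl by auto
  have "substructure \<tau> (reduct \<tau> M) N"
    using substructure_reduct[OF M] reduct_expand[OF N] by simp
  then have eq: "reduct \<tau> M = C"
    using substructure_univ_inj[OF _ le_substructure[OF C(1)]] C(2) univ_reduct by metis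
  then show "(reduct \<tau> M, N) \<in> le K" using C(1) by simp
  show "M = expand (reduct \<tau> M)"
    using substructure_univ_inj[OF M substructure_expand[OF C(1)]] C(2) eq
    by (simp add: expand_sel)
qed

text \<open>The expansion of the reduct of \<open>N\<close> is also a target of \<open>f\<close>
  from \<open>expand M\<close>, and transport of structure is unique.\<close>

lemma struct_iso_of_expand:
  assumes M: "M \<in> Mod K" and f: "struct_iso exp_voc f (expand M) N"
  shows "struct_iso \<tau> f M (reduct \<tau> N)" and "reduct \<tau> N \<in> Mod K" and "N = expand (reduct \<tau> N)"
proof -
  show iso: "struct_iso \<tau> f M (reduct \<tau> N)"
    using struct_iso_reduct[OF f] reduct_expand[OF M] by simp
  show "reduct \<tau> N \<in> Mod K"
    using Mod_iso[OF M iso] .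
  show "N = expand (reduct \<tau> N)"
    using struct_iso_unique[OF f struct_iso_expand[OF M iso]] .
qed

lemma substructure_expand_iff:
  assumes "M \<in> Mod K" "N \<in> Mod K"
  shows "substructure exp_voc (expand M) (expand N) \<longleftrightarrow> (M, N) \<in> le K"
  using substructure_expand substructure_of_expand(1)[OF assms(2)] reduct_expand[OF assms(1)] by metis

section \<open>Verification of the axioms for the expanded class\<close>

lemma exp_class_sel:
  "voc exp_class = exp_voc" "Mod exp_class = expand ` Mod K"
  by (simp_all add: exp_class_def)

lemma expand_le_iff:
  assumes "M \<in> Mod K" "N \<in> Mod K"
  shows "(expand M, expand N) \<in> le exp_class \<longleftrightarrow> (M, N) \<in> le K"
  using assms substructure_expand_iff by (auto simp: exp_class_def)

lemma le_exp_classE: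
  assumes "(M', N') \<in> le exp_class"
  obtains M N where "M' = expand M" "N' = expand N" "(M, N) \<in> le K"
  using assms substructure_expand_iff unfolding exp_class_def by auto

lemma closed_under_iso_expand: "closed_under_iso exp_voc (expand ` Mod K)"
  unfolding closed_under_iso_def using struct_iso_of_expand(2,3) by blast

lemma abstract_class_exp_class: "abstract_class \<mu> exp_class"
  unfolding abstract_class_def exp_class_sel
proof (intro conjI allI impI)
  show "partial_order_on (expand ` Mod K) (le exp_class)"
    unfolding partial_order_on_def preorder_on_def
  proof (intro conjI)
    show "le exp_class \<subseteq> expand ` Mod K \<times> expand ` Mod K"
      by (auto simp: exp_class_def)
    show "refl_on (expand ` Mod K) (le exp_class)"
      using is_structure_expand substructure_refl by (auto simp: refl_on_def exp_class_def)
    show "trans (le exp_class)"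
      using substructure_trans by (auto simp: trans_def exp_class_def)
    show "antisym (le exp_class)"
      using substructure_antisym substructure_subset
      by (auto simp: antisym_def exp_class_def) blast
  qed
  show "(M', N') \<in> le exp_class"
    if iso: "(M, N) \<in> le exp_class \<and> struct_iso exp_voc f N N' \<and> struct_iso exp_voc f M M'"
    for M N M' N' f
  proof -
    obtain M0 N0 where eq: "M = expand M0" "N = expand N0" and le: "(M0, N0) \<in> le K"
      using le_exp_classE[of M N] iso by blast
    have M0: "M0 \<in> Mod K" and N0: "N0 \<in> Mod K" using le_Mod[OF le] by auto
    note m = struct_iso_of_expand[OF M0, of f M'] and n = struct_iso_of_expand[OF N0, of f N']
    \<comment> \<open>Invariance under isomorphism is taken from \<open>K\<close> on the reducts and
      then lifted back.\<close>
    have "(reduct \<tau> M', reduct \<tau> N') \<in> le K"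
      using le_iso[OF le] m(1) n(1) iso eq by blast
    then have "(expand (reduct \<tau> M'), expand (reduct \<tau> N')) \<in> le exp_class"
      using expand_le_iff le_Mod by blast
    then show ?thesis using m(3) n(3) iso eq by simp
  qed
qed (use ary_exp_voc is_structure_expand closed_under_iso_expand in \<open>auto simp: exp_class_def\<close>)

lemma functorial_expansion_exp_class: "functorial_expansion \<mu> exp_class K"
  unfolding functorial_expansion_def exp_class_sel
proof (intro conjI ballI allI)
  show "bij_betw (reduct \<tau>) (expand ` Mod K) (Mod K)"
    using reduct_expand by (intro bij_betw_byWitness[where f' = expand]) auto
  fix M' N' f assume "M' \<in> expand ` Mod K" "N' \<in> expand ` Mod K"
  then obtain M N where M: "M \<in> Mod K" "M' = expand M" and N: "N \<in> Mod K" "N' = expand N"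
    by blast
  \<comment> \<open>The image through which an embedding factors is moved between the two classes by
    \<open>reduct\<close> and \<open>expand\<close>.\<close>
  have "(\<exists>P. struct_iso exp_voc f (expand M) P \<and> (P, expand N) \<in> le exp_class) \<longleftrightarrow>
      (\<exists>P. struct_iso \<tau> f M P \<and> (P, N) \<in> le K)"
  proof
    assume "\<exists>P. struct_iso exp_voc f (expand M) P \<and> (P, expand N) \<in> le exp_class"
    then obtain P where P: "struct_iso exp_voc f (expand M) P" "(P, expand N) \<in> le exp_class"
      by blast
    have "(reduct \<tau> P, N) \<in> le K"
      using P(2) substructure_of_expand(1)[OF N(1)] by (auto simp: exp_class_def)
    then show "\<exists>P. struct_iso \<tau> f M P \<and> (P, N) \<in> le K"
      using struct_iso_of_expand(1)[OF M(1) P(1)] by blast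
  next
    assume "\<exists>P. struct_iso \<tau> f M P \<and> (P, N) \<in> le K"
    then show "\<exists>P. struct_iso exp_voc f (expand M) P \<and> (P, expand N) \<in> le exp_class"
      using struct_iso_expand[OF M(1)] expand_le_iff le_Mod by blast
  qed
  then show "K_embedding exp_class f M' N' \<longleftrightarrow> K_embedding K f (reduct \<tau> M') (reduct \<tau> N')"
    unfolding K_embedding_def exp_class_sel using M N by (simp add: reduct_expand)
qed (rule abstract_class_exp_class exp_voc_extends)+

text \<open>Between expansions the substructure relation amounts to \<open>le K\<close> on the
  reducts. The reducts therefore form a \<mu>-directed system in \<open>K\<close>, to which the
  chain axioms apply.\<close>

lemma union_struct_expand:
  assumes D': "D' \<subseteq> expand ` Mod K"
    and dir: "directed_system \<mu> {(M, N). substructure exp_voc M N} D'"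
  shows "union_struct exp_voc D' \<in> expand ` Mod K"
proof -
  define D where "D = reduct \<tau> ` D'"
  have D: "D \<subseteq> Mod K" and exp: "\<And>M. M \<in> D \<Longrightarrow> expand M \<in> D'"
    and D'_D: "\<And>M'. M' \<in> D' \<Longrightarrow> \<exists>M \<in> D. M' = expand M"
    using D' reduct_expand unfolding D_def by force+
  have univ: "(\<Union>M \<in> D. univ M) = (\<Union>M \<in> D'. univ M)"
    by (simp add: D_def univ_reduct)
  have "\<exists>N \<in> D. \<forall>M \<in> S. (M, N) \<in> le K" if S: "S \<subseteq> D" "|S| <o \<mu>" for S
  proof -
    have "|expand ` S| <o \<mu>"
      using card_of_image S(2) by (rule ordLeq_ordLess_trans)
    moreover have "expand ` S \<subseteq> D'" using S(1) exp by blast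
    ultimately obtain N' where N': "N' \<in> D'" "\<forall>M \<in> expand ` S. substructure exp_voc M N'"
      using dir unfolding directed_system_def by auto
    obtain N where N: "N \<in> D" "N' = expand N" using D'_D[OF N'(1)] by blast
    then have "(M, N) \<in> le K" if "M \<in> S" for M
      using that N' S(1) D substructure_expand_iff by blast
    then show ?thesis using N(1) by blast
  qed
  then have "directed_system \<mu> (le K) D"
    using dir univ unfolding directed_system_def by simp
  then have U: "union_struct \<tau> D \<in> Mod K" and le: "\<And>M. M \<in> D \<Longrightarrow> (M, union_struct \<tau> D) \<in> le K"
    using AEC(3) D unfolding chain_axioms_def by blast+
  \<comment> \<open>By \<open>union_struct_eq\<close> it suffices that every member is a
    substructure of the expanded union and that the universes match.\<close>
  have "union_struct exp_voc D' = expand (union_struct \<tau> D)"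
  proof (rule union_struct_eq[OF ary_exp_voc dir])
    show "substructure exp_voc M (expand (union_struct \<tau> D))" if "M \<in> D'" for M
      using D'_D[OF that] substructure_expand[OF le] by blast
    show "univ (expand (union_struct \<tau> D)) = (\<Union>M \<in> D'. univ M)"
      using univ by (simp add: expand_sel union_struct_def)
  qed (use U is_structure_expand in \<open>auto dest: substructure_subset\<close>)
  then show ?thesis using U by blast
qed

lemma universal_exp_class: "universal_mu_AEC \<mu> exp_class"
  unfolding universal_mu_AEC_def mu_universal_class_def exp_class_sel
proof (intro conjI allI impI)
  show "M \<in> expand ` Mod K" if "N \<in> expand ` Mod K \<and> substructure exp_voc M N" for M N
    using that substructure_of_expand le_Mod(1) by blast
  show "le exp_class =
      {(M, N). M \<in> expand ` Mod K \<and> N \<in> expand ` Mod K \<and> substructure exp_voc M N}"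
    by (simp add: exp_class_def)
qed (use ary_exp_voc is_structure_expand closed_under_iso_expand union_struct_expand in auto)

end

theorem theorem2p8:
  fixes \<mu> :: "'i rel" and K :: "('s, 'i, 'a) aclass"
  assumes "Cinfinite \<mu>" and "regularCard \<mu>"
    and "pseudo_universal \<mu> K"
    and "\<forall>M \<in> Mod K. univ M \<noteq> {}"
  shows "\<exists>K' :: ('s + 'a set, 'i, 'a) aclass.
    functorial_expansion \<mu> K' K \<and> universal_mu_AEC \<mu> K' \<and>
    |symbols (voc K')| \<le>o ctwo ^c LS \<mu> K"
proof -
  interpret pseudo_universal_AEC \<mu> K
    using assms by unfold_locales auto
  show ?thesis
    using functorial_expansion_exp_class universal_exp_class card_symbols_exp_voc
    by (intro exI[of _ exp_class]) (simp add: exp_class_sel)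
qed

end
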